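(* Let $G$ be a connected directed tree (arbitrary edge orientation) with $N$ vertices and $m$ edges, let $0<\beta<1$, let $H$ be the stabilizing positive semidefinite solution of the reduced DARE, and let $F=-rD^{-1}(-S^\top+\beta C^\top H)$ and $Z=[\,C\ \ \mathbf 1\,]$. Let $P_F\in\{0,1\}^{m\times m}$ be the edge-column support of $FZ\in\mathbb{R}^{m\times N}$, i.e. $P_F(p,q)=1$ if and only if $(FZ)_{pq}\neq0$, for $p,q\in\{1,\dots,m\}$. Then, in Boolean matrix arithmetic and entrywise, $$P_F\le P_D^*\,P_G ,$$ i.e. whenever $(FZ)_{pq}\ne0$ with $q\le m$, there is an index $k$ with $P_D^*(p,k)=1$ and $P_G(k,q)=1$. (No zero is guaranteed in the last column of $FZ$, the one corresponding to the column $\mathbf 1$ of $Z$.)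
   Context: A connected directed tree is a finite directed graph whose underlying undirected graph is a tree (so $m=N-1$). Edge $e_i$ ($i=1,\dots,m$) is directed from its sender $s_i$ to its receiver $t_i$. Let $\hat e_v\in\mathbb{R}^N$ be the standard basis vector at vertex $v$ and $\mathbf 1$ the all-ones vector. The matrices $S,R\in\mathbb{R}^{N\times m}$ have $i$th columns $\hat e_{s_i}$ and $\hat e_{t_i}$ respectively, and $C=R-S$. Put $r=\sqrt\beta$. Reduced DARE: for symmetric $H\in\mathbb{R}^{N\times N}$ put $D=S^\top S+\beta C^\top HC$ and $N_H=-S+\beta HC$. The reduced DARE is $H=I+\beta H-N_HD^{-1}N_H^\top$, with $D$ required to be nonsingular. A solution $H$ is called stabilizing if every eigenvalue of $r(I-CD^{-1}N_H^\top)$ lies in the open unit disk. (The reduced DARE has exactly one stabilizing positive semidefinite solution.) Height components: $h:V\to\mathbb{Z}_{\ge0}$ is the unique function with $h(t_i)=h(s_i)+1$ for every edge $e_i$ and $\min_v h(v)=0$. For $a\in\mathbb{Z}$, $V_a=\{v\in V:h(v)\ge a\}$, and $G[V_a]$ is the induced subgraph. For each edge $e_i$ put $a_i=h(t_i)$ and let $\Omega_i$ be the vertex set of the connected component (ignoring orientations) of $G[V_{a_i}]$ containing $t_i$. Binary matrices $P_D,P_G\in\{0,1\}^{m\times m}$ are defined by $$P_D(p,q)=1\iff s_p=s_q\ \text{or}\ (a_p,\Omega_p)=(a_q,\Omega_q),$$ $$P_G(p,q)=1\iff C_{s_p,q}\neq0\ \text{or}\ (a_p,\Omega_p)=(a_q,\Omega_q),$$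 with entry $0$ otherwise. For a binary matrix $\Pi$, its transitive closure $\Pi^*$ has $\Pi^*(p,q)=1$ if there is a chain $i_0=p,i_1,\dots,i_\ell=q$ with $\Pi(i_{j-1},i_j)=1$ for every $j$, and $\Pi^*(p,q)=0$ otherwise. Boolean matrix arithmetic replaces multiplication by logical "and" and addition by logical "or". *)

theory Defs
  imports
    "Jordan_Normal_Form.Gauss_Jordan_Elimination"
    "Jordan_Normal_Form.Char_Poly"
    "Graph_Theory.Digraph_Component"
begin

section \<open>Directed trees\<close>

text \<open>
  A cycle of the underlying undirected multigraph, given by its vertices and its arcs in cyclic
  order. Loops (length 1) and pairs of parallel or antiparallel arcs (length 2) are cycles.
  The constants \<open>forest\<close> and \<open>tree\<close> of the digraph library are not what is needed
  here, since they only exclude directed cycles.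
\<close>

definition undirected_cycle :: "('a, 'b) pre_digraph \<Rightarrow> 'a list \<Rightarrow> 'b list \<Rightarrow> bool" where
  "undirected_cycle G vs es \<longleftrightarrow>
     vs \<noteq> [] \<and> length es = length vs \<and> distinct vs \<and> distinct es \<and> set es \<subseteq> arcs G \<and>
     (\<forall>i < length es. {tail G (es ! i), head G (es ! i)} = {vs ! i, vs ! (Suc i mod length vs)})"

definition directed_tree :: "('a, 'b) pre_digraph \<Rightarrow> bool" where
  "directed_tree G \<longleftrightarrow>
     fin_digraph G \<and> Digraph_Component.connected G \<and> (\<nexists>vs es. undirected_cycle G vs es)"


section \<open>Height components\<close>

definition height_function :: "('a, 'b) pre_digraph \<Rightarrow> ('a \<Rightarrow> nat) \<Rightarrow> bool" where
  "height_function G h \<longleftrightarrow>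
     (\<forall>e \<in> arcs G. h (head G e) = h (tail G e) + 1) \<and> Min (h ` verts G) = 0"

definition level_verts :: "('a, 'b) pre_digraph \<Rightarrow> ('a \<Rightarrow> nat) \<Rightarrow> nat \<Rightarrow> 'a set" where
  "level_verts G h a = {v \<in> verts G. a \<le> h v}"

definition arc_level :: "('a, 'b) pre_digraph \<Rightarrow> ('a \<Rightarrow> nat) \<Rightarrow> 'b \<Rightarrow> nat" where
  "arc_level G h e = h (head G e)"

definition height_component :: "('a, 'b) pre_digraph \<Rightarrow> ('a \<Rightarrow> nat) \<Rightarrow> 'b \<Rightarrow> 'a set" where
  "height_component G h e =
     {v. reachable (with_proj (mk_symmetric (G \<restriction> level_verts G h (arc_level G h e)))) (head G e) v}"


section \<open>Incidence matrices and the reduced DARE\<close>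

text \<open>
  Vertices and arcs serve as matrix indices, so the definitions below are meant for digraphs with
  \<open>verts G = {..<N}\<close> and \<open>arcs G = {..<m}\<close>.
\<close>

definition sender_mat :: "(nat, nat) pre_digraph \<Rightarrow> real mat" where
  "sender_mat G = mat_of_cols (card (verts G))
     (map (\<lambda>i. unit_vec (card (verts G)) (tail G i)) [0..<card (arcs G)])"

definition receiver_mat :: "(nat, nat) pre_digraph \<Rightarrow> real mat" where
  "receiver_mat G = mat_of_cols (card (verts G))
     (map (\<lambda>i. unit_vec (card (verts G)) (head G i)) [0..<card (arcs G)])"

definition incidence_mat :: "(nat, nat) pre_digraph \<Rightarrow> real mat" where
  "incidence_mat G = receiver_mat G - sender_mat G"

definition dare_D :: "(nat, nat) pre_digraph \<Rightarrow> real \<Rightarrow> real mat \<Rightarrow> real mat" where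
  "dare_D G \<beta> H =
     transpose_mat (sender_mat G) * sender_mat G
     + \<beta> \<cdot>\<^sub>m (transpose_mat (incidence_mat G) * H * incidence_mat G)"

definition dare_N :: "(nat, nat) pre_digraph \<Rightarrow> real \<Rightarrow> real mat \<Rightarrow> real mat" where
  "dare_N G \<beta> H = - sender_mat G + \<beta> \<cdot>\<^sub>m (H * incidence_mat G)"

text \<open>Meaningful for invertible \<open>dare_D G \<beta> H\<close> only.\<close>

definition dare_Dinv :: "(nat, nat) pre_digraph \<Rightarrow> real \<Rightarrow> real mat \<Rightarrow> real mat" where
  "dare_Dinv G \<beta> H = the (mat_inverse (dare_D G \<beta> H))"

definition reduced_dare_solution :: "(nat, nat) pre_digraph \<Rightarrow> real \<Rightarrow> real mat \<Rightarrow> bool" where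
  "reduced_dare_solution G \<beta> H \<longleftrightarrow>
     H \<in> carrier_mat (card (verts G)) (card (verts G)) \<and> transpose_mat H = H \<and>
     invertible_mat (dare_D G \<beta> H) \<and>
     H = 1\<^sub>m (card (verts G)) + \<beta> \<cdot>\<^sub>m H
         - dare_N G \<beta> H * dare_Dinv G \<beta> H * transpose_mat (dare_N G \<beta> H)"

definition stabilizing :: "(nat, nat) pre_digraph \<Rightarrow> real \<Rightarrow> real mat \<Rightarrow> bool" where
  "stabilizing G \<beta> H \<longleftrightarrow>
     (\<forall>z. eigenvalue
        (map_mat complex_of_real
          (sqrt \<beta> \<cdot>\<^sub>m (1\<^sub>m (card (verts G))
            - incidence_mat G * dare_Dinv G \<beta> H * transpose_mat (dare_N G \<beta> H)))) z
        \<longrightarrow> cmod z < 1)"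

definition pos_semidef :: "real mat \<Rightarrow> bool" where
  "pos_semidef A \<longleftrightarrow>
     square_mat A \<and> transpose_mat A = A \<and>
     (\<forall>x \<in> carrier_vec (dim_row A). 0 \<le> x \<bullet> (A *\<^sub>v x))"

definition gain_mat :: "(nat, nat) pre_digraph \<Rightarrow> real \<Rightarrow> real mat \<Rightarrow> real mat" where
  "gain_mat G \<beta> H =
     (- sqrt \<beta>) \<cdot>\<^sub>m (dare_Dinv G \<beta> H *
       (- transpose_mat (sender_mat G) + \<beta> \<cdot>\<^sub>m (transpose_mat (incidence_mat G) * H)))"

definition basis_mat :: "(nat, nat) pre_digraph \<Rightarrow> real mat" where
  "basis_mat G = mat_of_cols (card (verts G))
     (cols (incidence_mat G) @ [vec (card (verts G)) (\<lambda>_. 1)])"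


section \<open>Binary matrices\<close>

text \<open>
  A binary matrix indexed by the arcs is encoded as the relation of its positions with entry 1.
  The Boolean product then is relational composition \<open>O\<close>, the entrywise order is inclusion, and
  the transitive closure is \<open>\<^sup>+\<close>; chains of length 0 make no difference for \<open>P_D\<close>, which is
  reflexive on the arcs.
\<close>

definition P_D :: "(nat, nat) pre_digraph \<Rightarrow> (nat \<Rightarrow> nat) \<Rightarrow> (nat \<times> nat) set" where
  "P_D G h = {(p, q). p \<in> arcs G \<and> q \<in> arcs G \<and>
     (tail G p = tail G q \<or>
      (arc_level G h p, height_component G h p) = (arc_level G h q, height_component G h q))}"

definition P_G :: "(nat, nat) pre_digraph \<Rightarrow> (nat \<Rightarrow> nat) \<Rightarrow> (nat \<times> nat) set" where
  "P_G G h = {(p, q). p \<in> arcs G \<and> q \<in> arcs G \<and>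
     (incidence_mat G $$ (tail G p, q) \<noteq> 0 \<or>
      (arc_level G h p, height_component G h p) = (arc_level G h q, height_component G h q))}"

definition P_F :: "(nat, nat) pre_digraph \<Rightarrow> real \<Rightarrow> real mat \<Rightarrow> (nat \<times> nat) set" where
  "P_F G \<beta> H = {(p, q). p \<in> arcs G \<and> q \<in> arcs G \<and>
     (gain_mat G \<beta> H * basis_mat G) $$ (p, q) \<noteq> 0}"

end

theory Submission
  imports Defs
begin

text \<open>
  The reduced DARE belongs to a transport problem. A state \<open>x\<close> puts a mass on every vertex, a
  control \<open>u\<close> sends mass along the arcs, a step costs \<open>\<bar>x - S u\<bar>\<^sup>2\<close>, the
  squares of the masses left behind at the tails, and the next state \<open>x + C u\<close> is discounted
  by \<open>\<beta>\<close>. Arcs only lead one level up. So, with \<open>V a\<close> the set of vertices of height at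
  least \<open>a\<close>, a step changes the mass of a component of \<open>G[V a]\<close> only through the arcs that
  enter it from height \<open>a - 1\<close>, and the mass of a component can be split freely among its
  vertices of lowest height and the components one level up that it contains.
  Minimising level by level gives the optimal cost as a sum over the height components,
  \<open>H = (\<Sum>\<Omega>. c \<Omega> * \<one> \<Omega> * (\<one> \<Omega>)\<^sup>T)\<close>, where \<open>1 / c \<Omega>\<close> is the sum of
  \<open>\<beta> ^ (a - h w)\<close> over \<open>w \<in> \<Omega>\<close> for a component \<open>\<Omega>\<close> of \<open>G[V a]\<close>,
  with an extra factor \<open>1 / (1 - \<beta>)\<close> in \<open>c\<close> for \<open>a = 0\<close>, whose component is the whole
  graph and keeps its mass forever.

  An arc contributes to the mass of \<open>\<Omega>\<close> at level \<open>a\<close> exactly if its head has height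
  \<open>a\<close> and lies in \<open>\<Omega>\<close> (lemma \<open>crossing\<close>), that is, if \<open>\<Omega>\<close> is its own
  height component. Hence \<open>C\<^sup>T H C\<close> vanishes between arcs with different height components
  (\<open>optimal_value_arcs_support\<close>). So \<open>D = S\<^sup>T S + \<beta> C\<^sup>T H C\<close> is supported in
  \<open>P_D\<close>, its inverse is supported in the transitive closure because \<open>D\<close> is block diagonal
  for the equivalence relation it generates (\<open>dare_Dinv_support\<close>), and the matrix
  \<open>(-S\<^sup>T + \<beta> C\<^sup>T H) C\<close> is supported in \<open>P_G\<close>. Multiplying the two supports gives the claim.

  The real work is to identify the given \<open>H\<close> with the explicit sum
  (\<open>riccati_pair_unique\<close>). The explicit kernel satisfies the Riccati equations together with an
  explicit policy, which in each step spreads the mass of every component in proportion to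
  \<open>\<beta> ^ (- h w)\<close>. For two solutions with closed loops \<open>B\<close> and \<open>B'\<close>, the difference
  \<open>X\<close> satisfies \<open>X = \<beta> B\<^sup>T X B'\<close>, so \<open>X\<close> kills a state as soon as it kills the
  successor under \<open>B'\<close>. Under the explicit policy every state reaches, after finitely many steps,
  a multiple of the fixed state \<open>\<beta> ^ (- h w)\<close>. This fixed state is killed because otherwise
  \<open>1 / sqrt \<beta> > 1\<close> would be an eigenvalue of the stabilized matrix.
\<close>


section \<open>Components of the level graphs\<close>

locale height_graded_digraph = fin_digraph G
  for G :: "('a, 'b) pre_digraph" +
  fixes h :: "'a \<Rightarrow> nat" and \<beta> :: real
  assumes connected: "Digraph_Component.connected G"
    and height_head: "e \<in> arcs G \<Longrightarrow> h (head G e) = Suc (h (tail G e))"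
    and beta_pos: "0 < \<beta>" and beta_less_1: "\<beta> < 1"
begin

definition component :: "nat \<Rightarrow> 'a \<Rightarrow> 'a set" where
  "component a v = {w. reachable (with_proj (mk_symmetric (G \<restriction> level_verts G h a))) v w}"

lemma level_wf: "pair_wf_digraph (mk_symmetric (G \<restriction> level_verts G h a))"
  using wf_digraph.wellformed_mk_symmetric wellformed_induce_subgraph by blast

lemma component_member:
  assumes "w \<in> component a v"
  shows "v \<in> verts G" "w \<in> verts G" "a \<le> h v" "a \<le> h w"
proof -
  have "reachable (with_proj (mk_symmetric (G \<restriction> level_verts G h a))) v w"
    using assms by (simp add: component_def)
  then have "v \<in> level_verts G h a \<and> w \<in> level_verts G h a"
    by (rule reachable_in_vertsE) simp
  then show "v \<in> verts G" "w \<in> verts G" "a \<le> h v" "a \<le> h w"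
    by (simp_all add: level_verts_def)
qed

lemma component_subset: "component a v \<subseteq> verts G"
  using component_member by blast

lemma finite_component [simp, intro]: "finite (component a v)"
  using finite_subset[OF component_subset] by simp

lemma component_refl: "v \<in> verts G \<Longrightarrow> a \<le> h v \<Longrightarrow> v \<in> component a v"
  unfolding component_def
  by (simp add: reachable_def level_verts_def rtrancl_on_refl)

lemma component_eq:
  assumes "w \<in> component a v"
  shows "component a w = component a v"
proof -
  interpret L: pair_wf_digraph "mk_symmetric (G \<restriction> level_verts G h a)"
    by (rule level_wf)
  let ?R = "reachable (with_proj (mk_symmetric (G \<restriction> level_verts G h a)))"
  have vw: "?R v w" and wv: "?R w v"
    using assms symmetric_reachable[OF symmetric_mk_symmetric] by (simp_all add: component_def)
  then have "?R w u \<longleftrightarrow> ?R v u" for u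
    using L.reachable_trans[OF vw] L.reachable_trans[OF wv] by metis
  then show ?thesis by (simp add: component_def)
qed

lemma component_sym: "w \<in> component a v \<longleftrightarrow> v \<in> component a w"
proof -
  have "v \<in> component a w" if "w \<in> component a v" for v w
    using component_eq[OF that] component_refl[of v a] component_member[OF that] by simp
  then show ?thesis by blast
qed

lemma component_head:
  assumes "e \<in> arcs G" "a \<le> h (tail G e)"
  shows "component a (head G e) = component a (tail G e)"
proof -
  interpret L: pair_wf_digraph "mk_symmetric (G \<restriction> level_verts G h a)"
    by (rule level_wf)
  have "(tail G e, head G e) \<in> parcs (mk_symmetric (G \<restriction> level_verts G h a))"
    using assms height_head[of e] by (auto simp: parcs_mk_symmetric level_verts_def intro!: bexI[of _ e])
  then have "head G e \<in> component a (tail G e)"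
    unfolding component_def by (simp add: L.reachable_adjI)
  then show ?thesis by (rule component_eq)
qed

text \<open>
Propagation along the arcs of the level graph, in both directions. The height of the tail is the
smaller one, so it alone decides whether an arc belongs to the level graph.
\<close>

lemma component_induct [consumes 1, case_names refl arc]:
  assumes w: "w \<in> component a v" and refl: "P v"
    and arc: "\<And>e. e \<in> arcs G \<Longrightarrow> a \<le> h (tail G e) \<Longrightarrow> P (tail G e) \<longleftrightarrow> P (head G e)"
  shows "P w"
proof -
  interpret L: pair_wf_digraph "mk_symmetric (G \<restriction> level_verts G h a)"
    by (rule level_wf)
  have "reachable (with_proj (mk_symmetric (G \<restriction> level_verts G h a))) v w"
    using w by (simp add: component_def)
  then show ?thesis
  proof (induction rule: L.reachable_induct)
    case base
    show ?case by (rule refl)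
  next
    case (step x y)
    then show ?case
      using arc by (auto simp: parcs_mk_symmetric level_verts_def)
  qed
qed

lemma component_mono:
  assumes "b \<le> a" "w \<in> component a v"
  shows "component b w = component b v"
  using assms(2)
proof (induction rule: component_induct)
  case (arc e)
  then have "component b (head G e) = component b (tail G e)"
    using assms(1) by (intro component_head) auto
  then show ?case by simp
qed simp

lemma component_mono_subset: "b \<le> a \<Longrightarrow> component a v \<subseteq> component b v"
proof
  fix w assume b: "b \<le> a" and w: "w \<in> component a v"
  have "w \<in> component b w"
    using b component_member[OF w] by (intro component_refl) auto
  then show "w \<in> component b v" using component_mono[OF b w] by simp
qed

lemma component_0: "v \<in> verts G \<Longrightarrow> component 0 v = verts G"
proof
  assume v: "v \<in> verts G"
  have "G \<restriction> level_verts G h 0 = G"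
    by (rule pre_digraph.equality) (auto simp: level_verts_def)
  then show "verts G \<subseteq> component 0 v"
    using connected v by (auto simp: component_def connected_def elim: strongly_connectedE)
qed (rule component_subset)

text \<open>
The only way to enter a component of level \<open>a\<close> from outside is along an arc from height
\<open>a - 1\<close> to height \<open>a\<close>, and no arc leaves it. Everything about the block structure comes
from this identity.
\<close>

lemma crossing:
  assumes "e \<in> arcs G"
  shows "(of_bool (head G e \<in> component a v) - of_bool (tail G e \<in> component a v) :: real)
    = of_bool (h (head G e) = a \<and> head G e \<in> component a v)"
proof (cases "a \<le> h (tail G e)")
  case True
  then have "head G e \<in> component a v \<longleftrightarrow> tail G e \<in> component a v"
    using component_head[OF assms True] component_sym[of "head G e"] component_sym[of "tail G e"] by simp
  then show ?thesis using True height_head[OF assms] by auto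
next
  case False
  then have "tail G e \<notin> component a v" using component_member by blast
  then show ?thesis
    using False height_head[OF assms] component_member(4)[of "head G e" a v] by auto
qed


section \<open>Flows along arcs\<close>

definition outflow :: "('b \<Rightarrow> real) \<Rightarrow> 'a \<Rightarrow> real" where
  "outflow u v = (\<Sum>e\<in>out_arcs G v. u e)"

definition inflow :: "('b \<Rightarrow> real) \<Rightarrow> 'a \<Rightarrow> real" where
  "inflow u v = (\<Sum>e\<in>in_arcs G v. u e)"

text \<open>
  The states of the transport problem: \<open>kept u x\<close> is \<open>x - S u\<close>, whose squared norm is
  the cost of a step, and \<open>moved u x\<close> is the next state \<open>x + C u\<close>.
\<close>

definition kept :: "('b \<Rightarrow> real) \<Rightarrow> ('a \<Rightarrow> real) \<Rightarrow> 'a \<Rightarrow> real" where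
  "kept u x v = x v - outflow u v"

definition moved :: "('b \<Rightarrow> real) \<Rightarrow> ('a \<Rightarrow> real) \<Rightarrow> 'a \<Rightarrow> real" where
  "moved u x v = x v - outflow u v + inflow u v"

lemma sum_outflow: "(\<Sum>v\<in>verts G. w v * outflow u v) = (\<Sum>e\<in>arcs G. w (tail G e) * u e)"
proof -
  have "(\<Sum>v\<in>verts G. w v * outflow u v) = (\<Sum>v\<in>verts G. \<Sum>e\<in>{e\<in>arcs G. tail G e = v}. w (tail G e) * u e)"
    by (simp add: outflow_def out_arcs_def sum_distrib_left)
  also have "\<dots> = (\<Sum>e\<in>arcs G. w (tail G e) * u e)"
    by (rule sum.group) auto
  finally show ?thesis .
qed

lemma sum_inflow: "(\<Sum>v\<in>verts G. w v * inflow u v) = (\<Sum>e\<in>arcs G. w (head G e) * u e)"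
proof -
  have "(\<Sum>v\<in>verts G. w v * inflow u v) = (\<Sum>v\<in>verts G. \<Sum>e\<in>{e\<in>arcs G. head G e = v}. w (head G e) * u e)"
    by (simp add: inflow_def in_arcs_def sum_distrib_left)
  also have "\<dots> = (\<Sum>e\<in>arcs G. w (head G e) * u e)"
    by (rule sum.group) auto
  finally show ?thesis .
qed

lemma sum_component: "(\<Sum>w\<in>component a v. f w) = (\<Sum>w\<in>verts G. of_bool (w \<in> component a v) * (f w :: real))"
proof -
  have "(\<Sum>w\<in>component a v. f w) = (\<Sum>w\<in>component a v. of_bool (w \<in> component a v) * f w)"
    by (rule sum.cong) auto
  also have "\<dots> = (\<Sum>w\<in>verts G. of_bool (w \<in> component a v) * f w)"
    using component_subset by (intro sum.mono_neutral_left) auto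
  finally show ?thesis .
qed

lemma net_inflow_component:
  "(\<Sum>w\<in>component a v. inflow u w - outflow u w)
    = (\<Sum>e\<in>{e\<in>arcs G. h (head G e) = a \<and> head G e \<in> component a v}. u e)"
proof -
  let ?i = "\<lambda>w. of_bool (w \<in> component a v) :: real"
  have "(\<Sum>w\<in>component a v. inflow u w - outflow u w)
    = (\<Sum>w\<in>verts G. ?i w * inflow u w) - (\<Sum>w\<in>verts G. ?i w * outflow u w)"
    by (simp add: sum_component right_diff_distrib sum_subtractf)
  also have "\<dots> = (\<Sum>e\<in>arcs G. (?i (head G e) - ?i (tail G e)) * u e)"
    by (simp add: sum_outflow sum_inflow left_diff_distrib sum_subtractf)
  also have "\<dots> = (\<Sum>e\<in>arcs G. of_bool (h (head G e) = a \<and> head G e \<in> component a v) * u e)"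
    by (rule sum.cong) (simp_all only: crossing)
  also have "\<dots> = (\<Sum>e\<in>{e\<in>arcs G. h (head G e) = a \<and> head G e \<in> component a v}. u e)"
    by (rule sum.mono_neutral_cong_right) auto
  finally show ?thesis .
qed

lemma outflow_add_arc:
  assumes "e \<in> arcs G"
  shows "outflow (\<lambda>e'. f e' + c * of_bool (e' = e)) x = outflow f x + c * of_bool (x = tail G e)"
proof -
  have "(\<Sum>e'\<in>out_arcs G x. c * of_bool (e' = e)) = (\<Sum>e'\<in>out_arcs G x. if e' = e then c else 0)"
    by (rule sum.cong) auto
  also have "\<dots> = (if e \<in> out_arcs G x then c else 0)"
    by (rule sum.delta) (simp add: out_arcs_def)
  finally show ?thesis using assms by (simp add: outflow_def sum.distrib)
qed

lemma inflow_add_arc: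
  assumes "e \<in> arcs G"
  shows "inflow (\<lambda>e'. f e' + c * of_bool (e' = e)) x = inflow f x + c * of_bool (x = head G e)"
proof -
  have "(\<Sum>e'\<in>in_arcs G x. c * of_bool (e' = e)) = (\<Sum>e'\<in>in_arcs G x. if e' = e then c else 0)"
    by (rule sum.cong) auto
  also have "\<dots> = (if e \<in> in_arcs G x then c else 0)"
    by (rule sum.delta) (simp add: in_arcs_def)
  finally show ?thesis using assms by (simp add: inflow_def sum.distrib)
qed

text \<open>
A flow of one unit of mass from \<open>v\<close> to \<open>w\<close>, possibly against the orientation of arcs, that
uses only arcs of the level graph \<open>G[V a]\<close>.
\<close>

definition unit_flow :: "nat \<Rightarrow> 'a \<Rightarrow> 'a \<Rightarrow> ('b \<Rightarrow> real) \<Rightarrow> bool" where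
  "unit_flow a v w f \<longleftrightarrow> (\<forall>e\<in>arcs G. h (tail G e) < a \<longrightarrow> f e = 0) \<and>
    (\<forall>x. outflow f x - inflow f x = of_bool (x = v) - of_bool (x = w))"

lemma unit_flow_exists:
  assumes "w \<in> component a v"
  shows "\<exists>f. unit_flow a v w f"
  using assms
proof (induction rule: component_induct)
  case refl
  show ?case by (rule exI[of _ "\<lambda>_. 0"]) (simp add: unit_flow_def outflow_def inflow_def)
next
  case (arc e)
  have step: "unit_flow a v w' (\<lambda>e'. f e' + c * of_bool (e' = e))"
    if "unit_flow a v w f"
      and "\<And>x. c * of_bool (x = tail G e) - c * of_bool (x = head G e) = of_bool (x = w) - of_bool (x = w')"
    for w w' c f
    unfolding unit_flow_def
  proof (intro conjI allI ballI impI)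
    fix e' assume "e' \<in> arcs G" "h (tail G e') < a"
    then show "f e' + c * of_bool (e' = e) = 0"
      using that(1) arc(2) by (auto simp: unit_flow_def)
  next
    fix x
    have "outflow f x - inflow f x = of_bool (x = v) - of_bool (x = w)"
      using that(1) by (simp add: unit_flow_def)
    then show "outflow (\<lambda>e'. f e' + c * of_bool (e' = e)) x - inflow (\<lambda>e'. f e' + c * of_bool (e' = e)) x
      = of_bool (x = v) - of_bool (x = w')"
      using that(2)[of x] unfolding outflow_add_arc[OF arc(1)] inflow_add_arc[OF arc(1)] by linarith
  qed
  show ?case
    using step[of "tail G e" _ 1 "head G e"] step[of "head G e" _ "-1" "tail G e"] by auto
qed


section \<open>The optimal transport policy\<close>

text \<open>
Within a component at level \<open>a\<close> the optimal masses are proportional to these weights: mass that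
rests \<open>k\<close> levels higher is paid for \<open>k\<close> steps later, which is cheaper by the factor
\<open>\<beta> ^ k\<close>.
\<close>

definition weight :: "nat \<Rightarrow> 'a \<Rightarrow> real" where
  "weight a v = (1 / \<beta>) ^ (h v - a)"

definition component_weight :: "nat \<Rightarrow> 'a \<Rightarrow> real" where
  "component_weight a v = (\<Sum>w\<in>component a v. weight a w)"

definition component_sum :: "('a \<Rightarrow> real) \<Rightarrow> nat \<Rightarrow> 'a \<Rightarrow> real" where
  "component_sum x a v = (\<Sum>w\<in>component a v. x w)"

definition density :: "('a \<Rightarrow> real) \<Rightarrow> nat \<Rightarrow> 'a \<Rightarrow> real" where
  "density x a v = component_sum x a v / component_weight a v"

text \<open>
The policy sends the excess of every vertex of a component at level \<open>a\<close> to one root of the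
component. The excesses add up to zero, so nothing accumulates at the root. Mass above height
\<open>a\<close> is first identified with a representative of its component at level \<open>Suc a\<close>. Thus the flow on the arcs leaving height
\<open>a\<close> depends only on the masses at height \<open>a\<close> and on the total masses of the components
above, a fact that \<open>policy_zero_component_sums\<close> needs.
\<close>

definition representative :: "nat \<Rightarrow> 'a \<Rightarrow> 'a" where
  "representative a v = (SOME w. w \<in> component a v)"

definition collapse :: "nat \<Rightarrow> 'a \<Rightarrow> 'a" where
  "collapse a v = (if h v = a then v else representative (Suc a) v)"

definition route :: "nat \<Rightarrow> 'a \<Rightarrow> 'b \<Rightarrow> real" where
  "route a v = (SOME f. unit_flow a (collapse a v) (representative a v) f)"

definition excess :: "('a \<Rightarrow> real) \<Rightarrow> nat \<Rightarrow> 'a \<Rightarrow> real" where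
  "excess x a v = x v - weight a v * density x a v"

text \<open>
Each arc only serves the redistribution at the height of its tail: of the routes at level
\<open>a\<close>, only the parts on arcs from height \<open>a\<close> to \<open>Suc a\<close> are executed. The remaining
parts run inside components of level \<open>Suc a\<close> and are left to later steps.
\<close>

definition policy :: "('a \<Rightarrow> real) \<Rightarrow> 'b \<Rightarrow> real" where
  "policy x e = (let a = h (tail G e) in \<Sum>v\<in>component a (tail G e). excess x a v * route a v e)"

lemma weight_pos: "0 < weight a v"
  using beta_pos by (simp add: weight_def)

lemma component_weight_pos:
  assumes "v \<in> verts G" "a \<le> h v"
  shows "0 < component_weight a v"
  unfolding component_weight_def using component_refl[OF assms] weight_pos
  by (intro sum_pos) auto

lemma density_eq: "w \<in> component a v \<Longrightarrow> density x a w = density x a v"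
  by (simp add: density_def component_sum_def component_weight_def component_eq)

lemma representative_mem:
  assumes "v \<in> verts G" "a \<le> h v"
  shows "representative a v \<in> component a v"
  unfolding representative_def using component_refl[OF assms] by (rule someI)

lemma representative_eq: "w \<in> component a v \<Longrightarrow> representative a w = representative a v"
  by (simp add: representative_def component_eq)

lemma collapse_mem:
  assumes "v \<in> verts G" "a \<le> h v"
  shows "collapse a v \<in> component a v"
proof (cases "h v = a")
  case True
  then show ?thesis using component_refl[OF assms] by (simp add: collapse_def)
next
  case False
  then have "representative (Suc a) v \<in> component (Suc a) v"
    using assms by (intro representative_mem) auto
  then show ?thesis using False component_mono_subset[of a "Suc a" v] by (auto simp: collapse_def)
qed

lemma collapse_mem_above:
  assumes "u \<in> verts G" "a \<le> h u" "v \<in> verts G"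
  shows "collapse a u \<in> component (Suc a) v \<longleftrightarrow> u \<in> component (Suc a) v"
proof (cases "h u = a")
  case True
  then show ?thesis by (simp add: collapse_def)
next
  case False
  then have "representative (Suc a) u \<in> component (Suc a) u"
    using assms by (intro representative_mem) auto
  then have "component (Suc a) (representative (Suc a) u) = component (Suc a) u"
    by (rule component_eq)
  then show ?thesis
    using False component_sym[of _ "Suc a" v] by (simp add: collapse_def)
qed

lemma collapse_eq_bottom:
  assumes "u \<in> verts G" "a \<le> h u" "h v = a"
  shows "v = collapse a u \<longleftrightarrow> v = u"
proof (cases "h u = a")
  case False
  then have "representative (Suc a) u \<in> component (Suc a) u"
    using assms by (intro representative_mem) auto
  then have "Suc a \<le> h (collapse a u)"
    using False component_member(4) by (simp add: collapse_def)
  then show ?thesis using False assms by auto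
qed (simp add: collapse_def)

lemma route_unit_flow:
  assumes "v \<in> verts G" "a \<le> h v"
  shows "unit_flow a (collapse a v) (representative a v) (route a v)"
proof -
  have "representative a v \<in> component a (collapse a v)"
    using representative_mem[OF assms] component_eq[OF collapse_mem[OF assms]] by simp
  then show ?thesis unfolding route_def by (rule someI_ex[OF unit_flow_exists])
qed

lemma route_eq_above:
  assumes "w \<in> component (Suc a) v"
  shows "route a w = route a v"
proof -
  have "w \<in> component a v" using component_mono_subset[of a "Suc a" v] assms by auto
  then have "representative a w = representative a v" by (rule representative_eq)
  moreover have "collapse a w = collapse a v"
    using component_member(3,4)[OF assms] representative_eq[OF assms] by (simp add: collapse_def)
  ultimately show ?thesis by (simp add: route_def)
qed

lemma sum_weight_density:
  assumes "v \<in> verts G" "a \<le> h v"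
  shows "(\<Sum>w\<in>component a v. weight a w * density x a w) = component_sum x a v"
proof -
  have "(\<Sum>w\<in>component a v. weight a w * density x a w) = component_weight a v * density x a v"
    unfolding component_weight_def sum_distrib_right by (rule sum.cong) (simp_all add: density_eq)
  then show ?thesis using component_weight_pos[OF assms] by (simp add: density_def)
qed

lemma sum_excess:
  assumes "v \<in> verts G" "a \<le> h v"
  shows "(\<Sum>w\<in>component a v. excess x a w) = 0"
  using sum_weight_density[OF assms] by (simp add: excess_def sum_subtractf component_sum_def)

text \<open>
A route at level \<open>a\<close> vanishes on the arcs that enter height \<open>a\<close>, so at a vertex of that
height its whole divergence is outflow and the policy removes precisely the excess. What remains is
the desired mass, here with weight 1.
\<close>

lemma kept_policy:
  assumes v: "v \<in> verts G"
  shows "kept (policy x) x v = density x (h v) v"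
proof -
  define a where "a = h v"
  have out: "outflow (route a u) v = of_bool (v = u) - of_bool (v = representative a v)"
    if u: "u \<in> component a v" for u
  proof -
    have uf: "unit_flow a (collapse a u) (representative a u) (route a u)"
      using component_member[OF u] by (intro route_unit_flow) auto
    have "inflow (route a u) v = 0"
      unfolding inflow_def
    proof (rule sum.neutral, rule ballI)
      fix e assume "e \<in> in_arcs G v"
      then have "e \<in> arcs G" "h (tail G e) < a" using height_head[of e] by (auto simp: a_def)
      then show "route a u e = 0" using uf by (simp add: unit_flow_def)
    qed
    moreover have "outflow (route a u) v - inflow (route a u) v
        = of_bool (v = collapse a u) - of_bool (v = representative a u)"
      using uf by (simp add: unit_flow_def)
    ultimately show ?thesis
      using collapse_eq_bottom[OF component_member(2,4)[OF u], of v]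
      unfolding representative_eq[OF u] by (simp add: a_def)
  qed
  have "outflow (policy x) v = (\<Sum>e\<in>out_arcs G v. \<Sum>u\<in>component a v. excess x a u * route a u e)"
    unfolding outflow_def by (rule sum.cong) (simp_all add: policy_def Let_def a_def)
  also have "\<dots> = (\<Sum>u\<in>component a v. excess x a u * outflow (route a u) v)"
    unfolding outflow_def sum_distrib_left by (rule sum.swap)
  also have "\<dots> = (\<Sum>u\<in>component a v. (if v = u then excess x a u else 0)
      - excess x a u * of_bool (v = representative a v))"
    by (rule sum.cong) (auto simp: out right_diff_distrib)
  also have "\<dots> = excess x a v"
    using sum_excess[OF v, of a x] component_refl[OF v, of a]
    by (simp add: sum_subtractf a_def flip: sum_distrib_right)
  finally show ?thesis by (simp add: kept_def excess_def a_def weight_def)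
qed

lemma component_sum_moved:
  "component_sum (moved u x) a v = component_sum x a v
    + (\<Sum>e\<in>{e\<in>arcs G. h (head G e) = a \<and> head G e \<in> component a v}. u e)"
  using net_inflow_component[of u a v]
  by (simp add: component_sum_def moved_def sum.distrib sum_subtractf)

lemma component_sum_moved_0: "component_sum (moved u x) 0 v = component_sum x 0 v"
proof -
  have no: "{e\<in>arcs G. h (head G e) = 0 \<and> head G e \<in> component 0 v} = {}"
    using height_head by auto
  show ?thesis by (simp add: component_sum_moved[of u x 0 v] no)
qed

lemma component_weight_Suc:
  "(\<Sum>w\<in>component (Suc a) v. weight a w) = component_weight (Suc a) v / \<beta>"
  unfolding component_weight_def sum_divide_distrib
proof (rule sum.cong)
  fix w assume "w \<in> component (Suc a) v"
  then have "Suc a \<le> h w" by (rule component_member)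
  then have "h w - a = Suc (h w - Suc a)" by simp
  then show "weight a w = weight (Suc a) w / \<beta>" by (simp add: weight_def)
qed simp

text \<open>
The part of a route that is executed carries the right total mass into every component of level
\<open>Suc a\<close>, although perhaps not to the right vertices.
\<close>

lemma component_sum_policy:
  assumes v: "v \<in> verts G" and a: "Suc a \<le> h v"
  shows "component_sum (moved (policy x) x) (Suc a) v = component_weight (Suc a) v * density x a v / \<beta>"
proof -
  let ?E = "{e\<in>arcs G. h (head G e) = Suc a \<and> head G e \<in> component (Suc a) v}"
  have sub: "component (Suc a) v \<subseteq> component a v" by (rule component_mono_subset) simp
  have into: "(\<Sum>e\<in>?E. route a u e)
      = of_bool (representative a v \<in> component (Suc a) v) - of_bool (u \<in> component (Suc a) v)"
    if u: "u \<in> component a v" for u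
  proof -
    have uf: "unit_flow a (collapse a u) (representative a u) (route a u)"
      using component_member[OF u] by (intro route_unit_flow) auto
    have "(\<Sum>e\<in>?E. route a u e) = (\<Sum>w\<in>component (Suc a) v. inflow (route a u) w - outflow (route a u) w)"
      by (simp add: net_inflow_component)
    also have "\<dots> = (\<Sum>w\<in>component (Suc a) v.
        (if w = representative a u then 1 else 0) - (if w = collapse a u then 1 else 0))"
    proof (rule sum.cong)
      fix w
      have "outflow (route a u) w - inflow (route a u) w
          = of_bool (w = collapse a u) - of_bool (w = representative a u)"
        using uf by (simp add: unit_flow_def)
      then show "inflow (route a u) w - outflow (route a u) w
          = (if w = representative a u then 1 else 0) - (if w = collapse a u then 1 else 0)"
        by (simp add: of_bool_def split: if_splits)
    qed simp
    also have "\<dots> = of_bool (representative a u \<in> component (Suc a) v) - of_bool (collapse a u \<in> component (Suc a) v)"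
      by (simp add: sum_subtractf)
    finally show ?thesis
      using collapse_mem_above[OF component_member(2,4)[OF u] v]
      unfolding representative_eq[OF u] by simp
  qed
  have "(\<Sum>e\<in>?E. policy x e) = (\<Sum>e\<in>?E. \<Sum>u\<in>component a v. excess x a u * route a u e)"
  proof (rule sum.cong)
    fix e assume e: "e \<in> ?E"
    then have t: "h (tail G e) = a" using height_head[of e] by auto
    have "component a (head G e) = component a v"
      using e sub by (intro component_eq) auto
    then have "component a (tail G e) = component a v"
      using e t component_head[of e a] by simp
    then show "policy x e = (\<Sum>u\<in>component a v. excess x a u * route a u e)"
      by (simp add: policy_def Let_def t)
  qed simp
  also have "\<dots> = (\<Sum>u\<in>component a v. excess x a u * (\<Sum>e\<in>?E. route a u e))"
    unfolding sum_distrib_left by (rule sum.swap)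
  also have "\<dots> = (\<Sum>u\<in>component a v. excess x a u * of_bool (representative a v \<in> component (Suc a) v)
      - excess x a u * of_bool (u \<in> component (Suc a) v))"
    by (rule sum.cong) (simp_all add: into right_diff_distrib)
  also have "\<dots> = - (\<Sum>u\<in>component a v. excess x a u * of_bool (u \<in> component (Suc a) v))"
    using sum_excess[OF v, of a x] a by (simp add: sum_subtractf flip: sum_distrib_right)
  also have "(\<Sum>u\<in>component a v. excess x a u * of_bool (u \<in> component (Suc a) v))
      = (\<Sum>u\<in>component (Suc a) v. excess x a u)"
    using sub by (intro sum.mono_neutral_cong_right) auto
  also have "\<dots> = component_sum x (Suc a) v - (\<Sum>u\<in>component (Suc a) v. weight a u * density x a v)"
  proof -
    have "(\<Sum>u\<in>component (Suc a) v. weight a u * density x a u)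
        = (\<Sum>u\<in>component (Suc a) v. weight a u * density x a v)"
      using sub by (intro sum.cong) (auto simp: density_eq)
    then show ?thesis by (simp add: excess_def sum_subtractf component_sum_def)
  qed
  also have "(\<Sum>u\<in>component (Suc a) v. weight a u * density x a v)
      = component_weight (Suc a) v * density x a v / \<beta>"
    by (simp add: component_weight_Suc flip: sum_distrib_right)
  finally show ?thesis by (simp add: component_sum_moved)
qed


text \<open>
The state with the optimal proportions has no excess at any level, so the policy leaves it alone.
\<close>

lemma moved_policy_weight:
  assumes "v \<in> verts G"
  shows "moved (policy (weight 0)) (weight 0) v = weight 0 v"
proof -
  have "excess (weight 0) a w = 0" if w: "w \<in> verts G" "a \<le> h w" for a w
  proof -
    have shift: "weight 0 u = weight a u * (1 / \<beta>) ^ a" if "u \<in> component a w" for u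
      using component_member(4)[OF that] by (simp add: weight_def flip: power_add)
    have "component_sum (weight 0) a w = component_weight a w * (1 / \<beta>) ^ a"
      unfolding component_sum_def component_weight_def sum_distrib_right
      by (rule sum.cong) (simp_all add: shift)
    then have "density (weight 0) a w = (1 / \<beta>) ^ a"
      using component_weight_pos[OF w] by (simp add: density_def)
    then show ?thesis using shift[OF component_refl[OF w]] by (simp add: excess_def)
  qed
  then have "policy (weight 0) e = 0" for e
    unfolding policy_def Let_def using component_member by (intro sum.neutral) auto
  then show ?thesis by (simp add: moved_def outflow_def inflow_def)
qed

text \<open>
Grouping the vertices above height \<open>b\<close> by their components at level \<open>Suc b\<close>, on which the
routes are constant, turns their contribution into component sums, which vanish.
\<close>

lemma policy_zero_component_sums:
  assumes zero: "\<And>v a. v \<in> verts G \<Longrightarrow> a \<le> h v \<Longrightarrow> component_sum x a v = 0"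
    and low: "\<And>v. v \<in> verts G \<Longrightarrow> h v < k \<Longrightarrow> x v = 0"
    and e: "e \<in> arcs G" "h (tail G e) < k"
  shows "policy x e = 0"
proof -
  define b where "b = h (tail G e)"
  let ?K = "component b (tail G e)"
  let ?S = "{u \<in> ?K. Suc b \<le> h u}"
  have ex: "excess x b u = x u" if "u \<in> ?K" for u
    using zero[OF component_member(2,4)[OF that]] by (simp add: excess_def density_def)
  have "policy x e = (\<Sum>u\<in>?K. x u * route b u e)"
    unfolding policy_def Let_def b_def[symmetric] by (rule sum.cong) (simp_all add: ex)
  also have "\<dots> = (\<Sum>u\<in>?S. x u * route b u e)"
  proof (rule sum.mono_neutral_right)
    show "\<forall>u\<in>?K - ?S. x u * route b u e = 0"
    proof
      fix u assume u: "u \<in> ?K - ?S"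
      then have "h u < k" using e(2) b_def by auto
      then show "x u * route b u e = 0" using low[of u] component_member(2)[of u b] u by auto
    qed
  qed auto
  also have "\<dots> = (\<Sum>K\<in>component (Suc b) ` ?S. \<Sum>u\<in>{u\<in>?S. component (Suc b) u = K}. x u * route b u e)"
    by (rule sum.group[symmetric]) auto
  also have "\<dots> = 0"
  proof (rule sum.neutral, rule ballI)
    fix K assume "K \<in> component (Suc b) ` ?S"
    then obtain v where v: "v \<in> ?K" "Suc b \<le> h v" and K: "K = component (Suc b) v" by auto
    have "{u\<in>?S. component (Suc b) u = K} = component (Suc b) v"
    proof
      show "{u\<in>?S. component (Suc b) u = K} \<subseteq> component (Suc b) v"
      proof
        fix u assume u: "u \<in> {u\<in>?S. component (Suc b) u = K}"
        then have "u \<in> component (Suc b) u"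
          by (intro component_refl) (auto dest: component_member(2))
        then show "u \<in> component (Suc b) v" using u K by simp
      qed
      show "component (Suc b) v \<subseteq> {u\<in>?S. component (Suc b) u = K}"
      proof
        fix u assume u: "u \<in> component (Suc b) v"
        then have "u \<in> component b v" using component_mono_subset[of b "Suc b" v] by auto
        then have "u \<in> ?K" using component_eq[OF v(1)] by simp
        then show "u \<in> {u\<in>?S. component (Suc b) u = K}"
          using component_member(4)[OF u] component_eq[OF u] K by simp
      qed
    qed
    then have "(\<Sum>u\<in>{u\<in>?S. component (Suc b) u = K}. x u * route b u e)
        = (\<Sum>u\<in>component (Suc b) v. x u * route b v e)"
      by (intro sum.cong) (auto simp: route_eq_above)
    also have "\<dots> = component_sum x (Suc b) v * route b v e"
      by (simp add: component_sum_def sum_distrib_right)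
    also have "\<dots> = 0" using zero[OF component_member(2)[OF v(1)] v(2)] by simp
    finally show "(\<Sum>u\<in>{u\<in>?S. component (Suc b) u = K}. x u * route b u e) = 0" .
  qed
  finally show ?thesis .
qed

text \<open>
Once all component sums vanish, each step clears one more height from below. This makes the policy
nilpotent on such states.
\<close>

lemma moved_policy_low:
  assumes zero: "\<And>v a. v \<in> verts G \<Longrightarrow> a \<le> h v \<Longrightarrow> component_sum x a v = 0"
    and low: "\<And>v. v \<in> verts G \<Longrightarrow> h v < k \<Longrightarrow> x v = 0"
    and v: "v \<in> verts G" "h v < Suc k"
  shows "moved (policy x) x v = 0"
proof -
  have "inflow (policy x) v = 0"
    unfolding inflow_def
  proof (rule sum.neutral, rule ballI)
    fix e assume "e \<in> in_arcs G v"
    then have "e \<in> arcs G" "h (tail G e) < k" using height_head[of e] v(2) by auto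
    then show "policy x e = 0" by (intro policy_zero_component_sums zero low)
  qed
  moreover have "kept (policy x) x v = 0"
    using kept_policy[OF v(1)] zero[OF v(1)] by (simp add: density_def)
  ultimately show ?thesis by (simp add: moved_def kept_def)
qed


section \<open>The optimal cost\<close>

text \<open>
The mass in the component at level 0 never changes and is paid for in every step. The geometric
series of these costs is the factor \<open>1 / (1 - \<beta>)\<close>.
\<close>

definition coefficient :: "nat \<Rightarrow> 'a \<Rightarrow> real" where
  "coefficient a v = (if a = 0 then 1 / (1 - \<beta>) else 1) / component_weight a v"

definition optimal_value :: "'a \<Rightarrow> 'a \<Rightarrow> real" where
  "optimal_value v w = (\<Sum>a\<le>h v. of_bool (w \<in> component a v) * coefficient a v)"

definition act :: "('a \<Rightarrow> 'a \<Rightarrow> real) \<Rightarrow> ('a \<Rightarrow> real) \<Rightarrow> 'a \<Rightarrow> real" where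
  "act P x v = (\<Sum>w\<in>verts G. P v w * x w)"

lemma optimal_value_commute: "optimal_value v w = optimal_value w v"
proof -
  have sub: "optimal_value v w = (\<Sum>a\<le>h v + h w. of_bool (w \<in> component a v) * coefficient a v)" for v w
    unfolding optimal_value_def
  proof (rule sum.mono_neutral_left)
    show "\<forall>a\<in>{..h v + h w} - {..h v}. of_bool (w \<in> component a v) * coefficient a v = 0"
    proof
      fix a assume "a \<in> {..h v + h w} - {..h v}"
      then have "w \<notin> component a v" using component_member(3)[of w a v] by auto
      then show "of_bool (w \<in> component a v) * coefficient a v = 0" by simp
    qed
  qed auto
  have "of_bool (w \<in> component a v) * coefficient a v = of_bool (v \<in> component a w) * coefficient a w" for a
  proof (cases "w \<in> component a v")
    case True
    then show ?thesis
      using component_sym[of w a v] component_eq[OF True]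
      by (simp add: coefficient_def component_weight_def)
  qed (use component_sym[of w a v] in simp)
  then show ?thesis unfolding sub[of v w] sub[of w v] by (simp add: add.commute)
qed

lemma act_optimal_value: "act optimal_value x v = (\<Sum>a\<le>h v. coefficient a v * component_sum x a v)"
proof -
  have "act optimal_value x v = (\<Sum>w\<in>verts G. \<Sum>a\<le>h v. coefficient a v * (of_bool (w \<in> component a v) * x w))"
    unfolding act_def optimal_value_def sum_distrib_right by (intro sum.cong refl) (simp only: ac_simps)
  also have "\<dots> = (\<Sum>a\<le>h v. \<Sum>w\<in>verts G. coefficient a v * (of_bool (w \<in> component a v) * x w))"
    by (rule sum.swap)
  finally show ?thesis unfolding component_sum_def sum_component sum_distrib_left .
qed

lemma optimal_value_head_tail:
  assumes e: "e \<in> arcs G"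
  shows "optimal_value (head G e) w - optimal_value (tail G e) w
    = of_bool (w \<in> component (h (head G e)) (head G e)) * coefficient (h (head G e)) (head G e)"
proof -
  have "component a (head G e) = component a (tail G e)" if "a \<le> h (tail G e)" for a
    using component_head[OF e that] .
  then have "(\<Sum>a\<le>h (tail G e). of_bool (w \<in> component a (head G e)) * coefficient a (head G e))
      = optimal_value (tail G e) w"
    unfolding optimal_value_def
    by (intro sum.cong) (simp_all add: coefficient_def component_weight_def)
  then show ?thesis by (simp add: optimal_value_def[of "head G e"] height_head[OF e])
qed

lemma act_diff: "act P x v - act P x w = (\<Sum>u\<in>verts G. (P v u - P w u) * x u)"
  by (simp add: act_def sum_subtractf left_diff_distrib)

lemma act_optimal_value_head_tail:
  assumes e: "e \<in> arcs G"
  shows "act optimal_value x (head G e) - act optimal_value x (tail G e) = density x (h (head G e)) (head G e)"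
proof -
  let ?a = "h (head G e)"
  have "act optimal_value x (head G e) - act optimal_value x (tail G e)
      = (\<Sum>w\<in>verts G. coefficient ?a (head G e) * (of_bool (w \<in> component ?a (head G e)) * x w))"
    unfolding act_diff optimal_value_head_tail[OF e] by (intro sum.cong refl) (simp only: ac_simps)
  also have "\<dots> = coefficient ?a (head G e) * component_sum x ?a (head G e)"
    unfolding component_sum_def sum_component sum_distrib_left ..
  finally show ?thesis by (simp add: coefficient_def density_def height_head[OF e])
qed

lemma optimal_value_arcs_support:
  assumes e: "e \<in> arcs G" and f: "f \<in> arcs G"
    and nz: "optimal_value (head G e) (head G f) - optimal_value (tail G e) (head G f)
      - (optimal_value (head G e) (tail G f) - optimal_value (tail G e) (tail G f)) \<noteq> 0"
  shows "h (head G e) = h (head G f)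
    \<and> component (h (head G e)) (head G e) = component (h (head G f)) (head G f)"
proof -
  let ?a = "h (head G e)"
  have "optimal_value (head G e) (head G f) - optimal_value (tail G e) (head G f)
      - (optimal_value (head G e) (tail G f) - optimal_value (tail G e) (tail G f))
    = (of_bool (head G f \<in> component ?a (head G e)) - of_bool (tail G f \<in> component ?a (head G e)))
      * coefficient ?a (head G e)"
    by (simp add: optimal_value_head_tail[OF e] left_diff_distrib)
  then have "h (head G f) = ?a" "head G f \<in> component ?a (head G e)"
    using nz crossing[OF f, of ?a "head G e"] by (auto split: if_splits)
  then show ?thesis using component_eq[of "head G f" ?a "head G e"] by simp
qed


section \<open>Uniqueness of the stabilizing Riccati solution\<close>

definition inner :: "('a \<Rightarrow> real) \<Rightarrow> ('a \<Rightarrow> real) \<Rightarrow> real" where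
  "inner x y = (\<Sum>v\<in>verts G. x v * y v)"

text \<open>
The DARE without the inverse, for a kernel \<open>P\<close> and a state feedback \<open>k\<close>. With
\<open>u = k x\<close> the equations say \<open>P x = (x - S u) + \<beta> P (x + C u)\<close> and
\<open>S\<^sup>T (x - S u) = \<beta> C\<^sup>T P (x + C u)\<close>. The second one is the stationarity of the
cost in \<open>u\<close>.
\<close>

definition riccati_pair :: "('a \<Rightarrow> 'a \<Rightarrow> real) \<Rightarrow> (('a \<Rightarrow> real) \<Rightarrow> 'b \<Rightarrow> real) \<Rightarrow> bool" where
  "riccati_pair P k \<longleftrightarrow>
    (\<forall>v\<in>verts G. \<forall>w\<in>verts G. P v w = P w v) \<and>
    (\<forall>x. \<forall>v\<in>verts G. act P x v = kept (k x) x v + \<beta> * act P (moved (k x) x) v) \<and>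
    (\<forall>x. \<forall>e\<in>arcs G. kept (k x) x (tail G e)
       = \<beta> * (act P (moved (k x) x) (head G e) - act P (moved (k x) x) (tail G e)))"

text \<open>
By \<open>component_sum_policy\<close>, the term of level \<open>Suc a\<close> in the cost of the next state is the
density at level \<open>a\<close>. So passing to the next state shifts the sum over the levels by one. The
density at the own height of the vertex drops out of the sum and reappears as the kept mass.
\<close>

lemma riccati_pair_optimal_value: "riccati_pair optimal_value policy"
  unfolding riccati_pair_def
proof (intro conjI allI ballI)
  fix v w show "optimal_value v w = optimal_value w v" by (rule optimal_value_commute)
next
  fix x v assume v: "v \<in> verts G"
  let ?b = "moved (policy x) x"
  let ?t = "\<lambda>a. coefficient a v * component_sum x a v"
  have t0: "?t 0 = density x 0 v / (1 - \<beta>)"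
    by (simp add: coefficient_def density_def)
  have geo: "density x 0 v / (1 - \<beta>) = density x 0 v + \<beta> * (density x 0 v / (1 - \<beta>))"
    using beta_less_1 by (simp add: field_simps)
  have bottom: "?t 0 = density x 0 v + \<beta> * ?t 0" unfolding t0 by (rule geo)
  have level: "\<beta> * (coefficient (Suc a) v * component_sum ?b (Suc a) v) = density x a v"
    if "Suc a \<le> h v" for a
    using component_sum_policy[OF v that, of x] component_weight_pos[OF v that] beta_pos
    by (simp add: coefficient_def)
  have "\<beta> * act optimal_value ?b v = \<beta> * ?t 0 + (\<Sum>a<h v. density x a v)"
    unfolding act_optimal_value sum.atMost_shift distrib_left sum_distrib_left
    by (simp add: level component_sum_moved_0)
  moreover have "kept (policy x) x v = density x (h v) v" by (rule kept_policy[OF v])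
  moreover have "act optimal_value x v = ?t 0 - density x 0 v + (\<Sum>a\<le>h v. density x a v)"
    unfolding act_optimal_value sum.atMost_shift
    by (simp add: coefficient_def density_def)
  moreover have "(\<Sum>a\<le>h v. density x a v) = (\<Sum>a<h v. density x a v) + density x (h v) v"
    using sum.lessThan_Suc[of "\<lambda>a. density x a v" "h v"] by (simp only: lessThan_Suc_atMost)
  ultimately show "act optimal_value x v = kept (policy x) x v + \<beta> * act optimal_value ?b v"
    using bottom by linarith
next
  fix x e assume e: "e \<in> arcs G"
  let ?b = "moved (policy x) x"
  let ?a = "h (tail G e)"
  have hv: "head G e \<in> verts G" "Suc ?a \<le> h (head G e)" using e height_head[OF e] by auto
  have "\<beta> * density ?b (Suc ?a) (head G e) = density x ?a (head G e)"
    using component_sum_policy[OF hv, of x] component_weight_pos[OF hv] beta_pos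
    by (simp add: density_def[of ?b])
  also have "\<dots> = density x ?a (tail G e)"
    using component_head[OF e order_refl] by (simp add: density_def component_sum_def component_weight_def)
  also have "\<dots> = kept (policy x) x (tail G e)"
    using kept_policy[of "tail G e"] e by simp
  finally show "kept (policy x) x (tail G e)
      = \<beta> * (act optimal_value ?b (head G e) - act optimal_value ?b (tail G e))"
    by (simp add: act_optimal_value_head_tail[OF e] height_head[OF e])
qed

lemma inner_indicator: "v \<in> verts G \<Longrightarrow> inner (\<lambda>w. of_bool (w = v)) y = y v"
proof -
  assume v: "v \<in> verts G"
  have "inner (\<lambda>w. of_bool (w = v)) y = (\<Sum>w\<in>verts G. if w = v then y w else 0)"
    unfolding inner_def by (rule sum.cong) auto
  then show ?thesis using v by simp
qed

lemma inner_commute: "inner x y = inner y x"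
  by (simp add: inner_def mult.commute)

lemma inner_kept: "inner (kept u x) y = inner x y - (\<Sum>e\<in>arcs G. u e * y (tail G e))"
  using sum_outflow[of y u] by (simp add: inner_def kept_def algebra_simps sum_subtractf)

lemma inner_moved:
  "inner (moved u x) y = inner x y + (\<Sum>e\<in>arcs G. u e * (y (head G e) - y (tail G e)))"
  using sum_outflow[of y u] sum_inflow[of y u]
  by (simp add: inner_def moved_def algebra_simps sum.distrib sum_subtractf)

lemma inner_act_commute:
  assumes "\<forall>v\<in>verts G. \<forall>w\<in>verts G. P v w = P w v"
  shows "inner x (act P y) = inner y (act P x)"
proof -
  have "inner x (act P y) = (\<Sum>v\<in>verts G. \<Sum>w\<in>verts G. x v * (P v w * y w))"
    by (simp add: inner_def act_def sum_distrib_left)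
  also have "\<dots> = (\<Sum>w\<in>verts G. \<Sum>v\<in>verts G. x v * (P v w * y w))"
    by (rule sum.swap)
  also have "\<dots> = inner y (act P x)"
    unfolding inner_def act_def sum_distrib_left using assms
    by (intro sum.cong refl) (simp add: ac_simps)
  finally show ?thesis .
qed

text \<open>
Polarized dynamic programming: since \<open>k y\<close> is stationary, the first order terms in the
flow \<open>u\<close> cancel, and \<open>u\<close> is arbitrary. Taking for \<open>u\<close> the control of another solution
lets two solutions be compared.
\<close>

lemma riccati_exchange:
  assumes "riccati_pair P k"
  shows "inner x (act P y) = inner (kept u x) (kept (k y) y) + \<beta> * inner (moved u x) (act P (moved (k y) y))"
proof -
  let ?b = "moved (k y) y"
  have act_eq: "act P y v = kept (k y) y v + \<beta> * act P ?b v" if "v \<in> verts G" for v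
    using assms that unfolding riccati_pair_def by blast
  have arc_eq: "kept (k y) y (tail G e) = \<beta> * (act P ?b (head G e) - act P ?b (tail G e))"
    if "e \<in> arcs G" for e
    using assms that unfolding riccati_pair_def by blast
  have "inner x (act P y) = (\<Sum>v\<in>verts G. x v * kept (k y) y v + \<beta> * (x v * act P ?b v))"
    unfolding inner_def by (rule sum.cong) (simp_all only: act_eq distrib_left mult.left_commute)
  then have "inner x (act P y) = inner x (kept (k y) y) + \<beta> * inner x (act P ?b)"
    by (simp only: inner_def sum.distrib sum_distrib_left)
  moreover have "(\<Sum>e\<in>arcs G. u e * kept (k y) y (tail G e))
      = \<beta> * (\<Sum>e\<in>arcs G. u e * (act P ?b (head G e) - act P ?b (tail G e)))"
    unfolding sum_distrib_left by (rule sum.cong) (simp_all only: arc_eq mult.left_commute)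
  ultimately show ?thesis by (simp add: inner_kept inner_moved distrib_left)
qed

text \<open>
The gap between the two kernels kills a state if it kills the state after one step of the explicit
policy. That policy first empties the component sums level by level, if the total mass is zero,
then the masses height by height. What is left over is the fixed state \<open>weight 0\<close>, on which
the gap takes a value \<open>w\<close> with \<open>w = \<beta> B\<^sup>T w\<close> for the closed loop \<open>B\<close> of \<open>k\<close>,
so that \<open>w = 0\<close> by \<open>stable\<close>.
\<close>

lemma riccati_pair_unique:
  assumes P: "riccati_pair P k"
    and stable: "\<And>w. (\<And>x. inner x w = \<beta> * inner (moved (k x) x) w) \<Longrightarrow> \<forall>v\<in>verts G. w v = 0"
    and v: "v \<in> verts G" and w: "w \<in> verts G"
  shows "P v w = optimal_value v w"
proof -
  define gap where "gap = (\<lambda>v w. P v w - optimal_value v w)"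
  define killed where "killed x \<longleftrightarrow> (\<forall>v\<in>verts G. act gap x v = 0)" for x
  obtain M where M: "\<And>v. v \<in> verts G \<Longrightarrow> h v < M"
    using finite_nat_set_iff_bounded[of "h ` verts G"] by auto
  have act_gap: "act gap x v = act P x v - act optimal_value x v" for x v
    by (simp add: gap_def act_def left_diff_distrib sum_subtractf)
  have step: "inner x (act gap y) = \<beta> * inner (moved (k x) x) (act gap (moved (policy y) y))" for x y
  proof -
    have symP: "inner x (act P y) = inner y (act P x)" for x y
      using inner_act_commute P unfolding riccati_pair_def by blast
    have "inner x (act optimal_value y) = inner (kept (k x) x) (kept (policy y) y)
        + \<beta> * inner (moved (k x) x) (act optimal_value (moved (policy y) y))"
      by (rule riccati_exchange[OF riccati_pair_optimal_value])
    moreover have "inner x (act P y) = inner (kept (k x) x) (kept (policy y) y)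
        + \<beta> * inner (moved (k x) x) (act P (moved (policy y) y))"
      using riccati_exchange[OF P, of y x "policy y"] symP[of y x]
        inner_commute[of "kept (policy y) y"] symP[of "moved (policy y) y"] by simp
    ultimately show ?thesis
      by (simp add: act_gap inner_def right_diff_distrib sum_subtractf)
  qed
  have killedI: "killed y" if "\<And>x. inner x (act gap y) = 0" for y
    unfolding killed_def using inner_indicator[of _ "act gap y"] that by auto
  have pull: "killed y" if "killed (moved (policy y) y)" for y
  proof (rule killedI)
    show "inner x (act gap y) = 0" for x
      unfolding step[of x y] using that by (simp add: killed_def inner_def)
  qed
  have stationary: "killed (weight 0)"
  proof -
    have fixed: "act gap (moved (policy (weight 0)) (weight 0)) = act gap (weight 0)"
      by (rule ext) (simp add: act_def moved_policy_weight)
    show ?thesis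
      unfolding killed_def using step[of _ "weight 0"] unfolding fixed by (rule stable)
  qed
  have sums_moved: "component_sum (moved (policy x) x) a v = 0"
    if "v \<in> verts G" "a \<le> h v" "component_sum x 0 v = 0" "\<And>b. a = Suc b \<Longrightarrow> component_sum x b v = 0" for x a v
  proof (cases a)
    case 0
    then show ?thesis using that by (simp add: component_sum_moved_0)
  next
    case (Suc b)
    then show ?thesis using that component_sum_policy[of v b x] by (simp add: density_def)
  qed
  \<comment> \<open>Here \<open>j\<close> counts the heights that are already empty.\<close>
  have zero_sums: "killed x"
    if "\<And>v a. v \<in> verts G \<Longrightarrow> a \<le> h v \<Longrightarrow> component_sum x a v = 0"
      and "\<And>v. v \<in> verts G \<Longrightarrow> h v < j \<Longrightarrow> x v = 0" for x j
    using that
  proof (induction "M - j" arbitrary: j x)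
    case 0
    then have "x v = 0" if "v \<in> verts G" for v using that M[OF that] by simp
    then show ?case by (simp add: killed_def act_def)
  next
    case (Suc n)
    have "killed (moved (policy x) x)"
    proof (rule Suc.hyps(1)[of "Suc j"])
      show "n = M - Suc j" using Suc.hyps(2) by simp
      show "component_sum (moved (policy x) x) a v = 0" if "v \<in> verts G" "a \<le> h v" for v a
        using that Suc.prems(1) by (intro sums_moved) auto
      show "moved (policy x) x v = 0" if "v \<in> verts G" "h v < Suc j" for v
        using moved_policy_low[of x j v] Suc.prems that by blast
    qed
    then show ?case by (rule pull)
  qed
  \<comment> \<open>Here \<open>j\<close> counts the levels whose component sums already vanish. Level 0 must be one of
    them, since its sum is conserved.\<close>
  have low_sums: "killed x"
    if "0 < j" "\<And>v a. v \<in> verts G \<Longrightarrow> a \<le> h v \<Longrightarrow> a < j \<Longrightarrow> component_sum x a v = 0" for x j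
    using that
  proof (induction "M - j" arbitrary: j x)
    case 0
    show ?case
    proof (rule zero_sums[of _ 0])
      show "component_sum x a v = 0" if "v \<in> verts G" "a \<le> h v" for v a
        using 0 M[OF that(1)] that by simp
    qed simp
  next
    case (Suc n)
    have "killed (moved (policy x) x)"
    proof (rule Suc.hyps(1)[of "Suc j"])
      show "n = M - Suc j" using Suc.hyps(2) by simp
      show "component_sum (moved (policy x) x) a v = 0" if "v \<in> verts G" "a \<le> h v" "a < Suc j" for v a
        using that Suc.prems by (intro sums_moved) auto
    qed simp
    then show ?case by (rule pull)
  qed
  have killed_all: "killed x" for x
  proof -
    \<comment> \<open>Subtracting a multiple of the fixed state makes the total mass zero.\<close>
    have ex: "killed (excess x 0)"
      by (rule low_sums[of 1]) (use sum_excess in \<open>simp_all add: component_sum_def\<close>)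
    have dens: "density x 0 w = density x 0 v" if "w \<in> verts G" for w
      using that component_0[OF v] by (intro density_eq) simp
    have "act gap x u = act gap (excess x 0) u + density x 0 v * act gap (weight 0) u" for u
      unfolding act_def sum_distrib_left sum.distrib[symmetric]
      by (rule sum.cong) (auto simp: excess_def dens algebra_simps)
    then show ?thesis using ex stationary by (simp add: killed_def)
  qed
  have "act gap (\<lambda>u. of_bool (u = w)) v = gap v w"
    using inner_indicator[OF w, of "gap v"] by (simp add: act_def inner_def mult.commute)
  then show ?thesis using killed_all v by (simp add: killed_def gap_def)
qed

end


section \<open>Matrix form\<close>

locale indexed_height_digraph = height_graded_digraph G h \<beta>
  for G :: "(nat, nat) pre_digraph" and h \<beta> +
  fixes N m :: nat
  assumes verts_eq: "verts G = {..<N}" and arcs_eq: "arcs G = {..<m}"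
begin

lemma ends_less: "e < m \<Longrightarrow> head G e < N" "e < m \<Longrightarrow> tail G e < N"
  using head_in_verts tail_in_verts verts_eq arcs_eq by auto

lemma sender_mat_carrier [simp, intro]: "sender_mat G \<in> carrier_mat N m"
  by (simp add: sender_mat_def verts_eq arcs_eq mat_of_cols_def)

lemma receiver_mat_carrier [simp, intro]: "receiver_mat G \<in> carrier_mat N m"
  by (simp add: receiver_mat_def verts_eq arcs_eq mat_of_cols_def)

lemma incidence_mat_carrier [simp, intro]: "incidence_mat G \<in> carrier_mat N m"
  unfolding incidence_mat_def by (rule minus_carrier_mat) simp

lemmas graph_mat_dims [simp] =
  carrier_matD[OF sender_mat_carrier] carrier_matD[OF receiver_mat_carrier]
  carrier_matD[OF incidence_mat_carrier]

lemma index_sender_mat: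
  "i < N \<Longrightarrow> e < m \<Longrightarrow> sender_mat G $$ (i, e) = of_bool (i = tail G e)"
  using ends_less by (simp add: sender_mat_def verts_eq arcs_eq mat_of_cols_index)

lemma index_receiver_mat:
  "i < N \<Longrightarrow> e < m \<Longrightarrow> receiver_mat G $$ (i, e) = of_bool (i = head G e)"
  using ends_less by (simp add: receiver_mat_def verts_eq arcs_eq mat_of_cols_index)

lemma index_incidence_mat:
  "i < N \<Longrightarrow> e < m \<Longrightarrow> incidence_mat G $$ (i, e) = of_bool (i = head G e) - of_bool (i = tail G e)"
  using index_receiver_mat[of i e] index_sender_mat[of i e]
  by (simp add: incidence_mat_def)

lemma index_mult_mat_sum:
  assumes "A \<in> carrier_mat k l" "B \<in> carrier_mat l n" "i < k" "j < n"
  shows "(A * B) $$ (i, j) = (\<Sum>q<l. A $$ (i, q) * B $$ (q, j))"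
  using assms by (simp add: scalar_prod_def atLeast0LessThan)

lemma sum_of_bool_mult: "t < N \<Longrightarrow> (\<Sum>i<N. of_bool (i = t) * f i) = (f t :: real)"
proof -
  assume t: "t < N"
  have "(\<Sum>i<N. of_bool (i = t) * f i) = (\<Sum>i<N. if i = t then f i else 0)"
    by (rule sum.cong) auto
  then show ?thesis using t by simp
qed

lemma index_mult_incidence:
  assumes "A \<in> carrier_mat k N" "i < k" "e < m"
  shows "(A * incidence_mat G) $$ (i, e) = A $$ (i, head G e) - A $$ (i, tail G e)"
proof -
  have "(A * incidence_mat G) $$ (i, e)
      = (\<Sum>j<N. of_bool (j = head G e) * A $$ (i, j)) - (\<Sum>j<N. of_bool (j = tail G e) * A $$ (i, j))"
    unfolding index_mult_mat_sum[OF assms(1) incidence_mat_carrier assms(2,3)] sum_subtractf[symmetric]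
    by (rule sum.cong) (simp_all add: index_incidence_mat assms(3) algebra_simps)
  then show ?thesis using sum_of_bool_mult ends_less[OF assms(3)] by simp
qed

lemma index_incidence_transpose_mult:
  assumes "A \<in> carrier_mat N k" "e < m" "i < k"
  shows "(transpose_mat (incidence_mat G) * A) $$ (e, i) = A $$ (head G e, i) - A $$ (tail G e, i)"
proof -
  have "(transpose_mat (incidence_mat G) * A) $$ (e, i)
      = (\<Sum>j<N. of_bool (j = head G e) * A $$ (j, i)) - (\<Sum>j<N. of_bool (j = tail G e) * A $$ (j, i))"
    unfolding index_mult_mat_sum[OF transpose_carrier_mat[THEN iffD2, OF incidence_mat_carrier] assms(1,2,3)]
      sum_subtractf[symmetric]
    by (intro sum.cong refl) (simp add: index_incidence_mat assms(2) algebra_simps)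
  then show ?thesis using sum_of_bool_mult ends_less[OF assms(2)] by simp
qed

lemma index_sender_gram:
  assumes "p < m" "q < m"
  shows "(transpose_mat (sender_mat G) * sender_mat G) $$ (p, q) = of_bool (tail G p = tail G q)"
proof -
  have "(transpose_mat (sender_mat G) * sender_mat G) $$ (p, q)
      = (\<Sum>j<N. of_bool (j = tail G p) * of_bool (j = tail G q))"
    unfolding index_mult_mat_sum[OF transpose_carrier_mat[THEN iffD2, OF sender_mat_carrier]
        sender_mat_carrier assms]
    using assms by (intro sum.cong refl) (simp add: index_sender_mat)
  then show ?thesis using sum_of_bool_mult ends_less[OF assms(1)] by simp
qed

end

locale dare_solution = indexed_height_digraph G h \<beta> N m
  for G :: "(nat, nat) pre_digraph" and h \<beta> N m +
  fixes H :: "real mat"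
  assumes solution: "reduced_dare_solution G \<beta> H"
begin

lemma H_carrier [simp, intro]: "H \<in> carrier_mat N N"
  using solution by (simp add: reduced_dare_solution_def verts_eq)

lemmas H_dims [simp] = carrier_matD[OF H_carrier]

lemma H_sym: "i < N \<Longrightarrow> j < N \<Longrightarrow> H $$ (i, j) = H $$ (j, i)"
proof -
  assume ij: "i < N" "j < N"
  have "transpose_mat H = H" using solution by (simp add: reduced_dare_solution_def)
  then have "H $$ (i, j) = transpose_mat H $$ (i, j)" by simp
  also have "\<dots> = H $$ (j, i)" using ij by simp
  finally show ?thesis .
qed

text \<open>
The entries of \<open>C\<^sup>T H C\<close>.
\<close>

definition arc_diff :: "nat \<Rightarrow> nat \<Rightarrow> real" where
  "arc_diff p q = H $$ (head G p, head G q) - H $$ (tail G p, head G q)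
    - (H $$ (head G p, tail G q) - H $$ (tail G p, tail G q))"

lemma dare_D_carrier [simp, intro]: "dare_D G \<beta> H \<in> carrier_mat m m"
  by (rule carrier_matI) (simp_all add: dare_D_def)

lemma dare_N_carrier [simp, intro]: "dare_N G \<beta> H \<in> carrier_mat N m"
  by (rule carrier_matI) (simp_all add: dare_N_def)

lemmas dare_dims [simp] = carrier_matD[OF dare_D_carrier] carrier_matD[OF dare_N_carrier]

lemma index_dare_D:
  assumes "p < m" "q < m"
  shows "dare_D G \<beta> H $$ (p, q) = of_bool (tail G p = tail G q) + \<beta> * arc_diff p q"
proof -
  have CtH: "transpose_mat (incidence_mat G) * H \<in> carrier_mat m N"
    by (intro mult_carrier_mat[OF _ H_carrier]) simp
  have "(transpose_mat (incidence_mat G) * H * incidence_mat G) $$ (p, q) = arc_diff p q"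
    using index_mult_incidence[OF CtH assms] assms ends_less
    by (simp add: index_incidence_transpose_mult[OF H_carrier] arc_diff_def del: index_mult_mat(1))
  then show ?thesis
    using assms index_sender_gram[OF assms]
    unfolding dare_D_def by (simp del: index_mult_mat(1))
qed

lemma index_dare_N:
  assumes "i < N" "e < m"
  shows "dare_N G \<beta> H $$ (i, e)
    = - of_bool (i = tail G e) + \<beta> * (H $$ (i, head G e) - H $$ (i, tail G e))"
  using assms
  by (simp add: dare_N_def index_sender_mat index_mult_incidence[OF H_carrier] del: index_mult_mat(1))

lemma dare_Dinv:
  shows dare_D_Dinv: "dare_D G \<beta> H * dare_Dinv G \<beta> H = 1\<^sub>m m"
    and dare_Dinv_D: "dare_Dinv G \<beta> H * dare_D G \<beta> H = 1\<^sub>m m"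
    and dare_Dinv_carrier [simp]: "dare_Dinv G \<beta> H \<in> carrier_mat m m"
proof -
  have D: "dare_D G \<beta> H \<in> carrier_mat m m" by simp
  obtain B where B: "dare_D G \<beta> H * B = 1\<^sub>m m" "B * dare_D G \<beta> H = 1\<^sub>m (dim_row B)"
    using solution D unfolding reduced_dare_solution_def invertible_mat_def inverts_mat_def by auto
  have "dim_col B = m" using arg_cong[OF B(1), of dim_col] by simp
  moreover have "dim_row B = m" using arg_cong[OF B(2), of dim_col] D by simp
  ultimately have "B \<in> carrier_mat m m" "B * dare_D G \<beta> H = 1\<^sub>m m" using B(2) by auto
  then have "dare_D G \<beta> H \<in> Units (ring_mat TYPE(real) m ())"
    using B(1) D by (auto simp: Units_def ring_mat_simps)
  then obtain E where E: "mat_inverse (dare_D G \<beta> H) = Some E"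
    using mat_inverse(1)[OF D, of "()"] by (cases "mat_inverse (dare_D G \<beta> H)") auto
  then show "dare_D G \<beta> H * dare_Dinv G \<beta> H = 1\<^sub>m m" "dare_Dinv G \<beta> H * dare_D G \<beta> H = 1\<^sub>m m"
    "dare_Dinv G \<beta> H \<in> carrier_mat m m"
    using mat_inverse(2)[OF D E] by (simp_all add: dare_Dinv_def)
qed

definition feedback :: "real mat" where
  "feedback = dare_Dinv G \<beta> H * transpose_mat (dare_N G \<beta> H)"

definition control :: "(nat \<Rightarrow> real) \<Rightarrow> nat \<Rightarrow> real" where
  "control x e = - (\<Sum>j<N. feedback $$ (e, j) * x j)"

lemma feedback_carrier [simp]: "feedback \<in> carrier_mat m N"
  unfolding feedback_def by (rule mult_carrier_mat[OF dare_Dinv_carrier]) simp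

lemma sum_control:
  "(\<Sum>e<m. a e * control x e) = - (\<Sum>j<N. (\<Sum>e<m. a e * feedback $$ (e, j)) * x j)"
proof -
  have "(\<Sum>e<m. a e * control x e) = - (\<Sum>e<m. \<Sum>j<N. a e * feedback $$ (e, j) * x j)"
    by (simp add: control_def sum_distrib_left sum_negf mult.assoc)
  also have "(\<Sum>e<m. \<Sum>j<N. a e * feedback $$ (e, j) * x j) = (\<Sum>j<N. \<Sum>e<m. a e * feedback $$ (e, j) * x j)"
    by (rule sum.swap)
  finally show ?thesis by (simp add: sum_distrib_right)
qed

lemma dare_D_control:
  assumes p: "p < m"
  shows "(\<Sum>q<m. dare_D G \<beta> H $$ (p, q) * control x q) = - (\<Sum>j<N. dare_N G \<beta> H $$ (j, p) * x j)"
proof -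
  have Nt: "transpose_mat (dare_N G \<beta> H) \<in> carrier_mat m N" by simp
  have "dare_D G \<beta> H * feedback = transpose_mat (dare_N G \<beta> H)"
    unfolding feedback_def
      assoc_mult_mat[OF dare_D_carrier dare_Dinv_carrier Nt, symmetric] dare_D_Dinv
    by (rule left_mult_one_mat[OF Nt])
  then have "(\<Sum>q<m. dare_D G \<beta> H $$ (p, q) * feedback $$ (q, j)) = dare_N G \<beta> H $$ (j, p)"
    if "j < N" for j
    using index_mult_mat_sum[OF dare_D_carrier feedback_carrier p that] p that dare_N_carrier by simp
  then show ?thesis by (simp add: sum_control)
qed

lemma dare_H_control:
  assumes i: "i < N"
  shows "(\<Sum>j<N. H $$ (i, j) * x j)
    = x i + \<beta> * (\<Sum>j<N. H $$ (i, j) * x j) + (\<Sum>e<m. dare_N G \<beta> H $$ (i, e) * control x e)"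
proof -
  have Nt: "transpose_mat (dare_N G \<beta> H) \<in> carrier_mat m N" by simp
  have NF: "dare_N G \<beta> H * feedback \<in> carrier_mat N N"
    by (rule mult_carrier_mat[OF dare_N_carrier feedback_carrier])
  have eq: "H = 1\<^sub>m N + \<beta> \<cdot>\<^sub>m H - dare_N G \<beta> H * feedback"
  proof -
    have card: "card (verts G) = N" by (simp add: verts_eq)
    have "H = 1\<^sub>m (card (verts G)) + \<beta> \<cdot>\<^sub>m H
        - dare_N G \<beta> H * dare_Dinv G \<beta> H * transpose_mat (dare_N G \<beta> H)"
      using solution unfolding reduced_dare_solution_def by (elim conjE)
    then show ?thesis
      unfolding feedback_def card assoc_mult_mat[OF dare_N_carrier dare_Dinv_carrier Nt] .
  qed
  have entry: "H $$ (i, j) = of_bool (j = i) + \<beta> * H $$ (i, j)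
      - (\<Sum>e<m. dare_N G \<beta> H $$ (i, e) * feedback $$ (e, j))" if j: "j < N" for j
  proof -
    have "H $$ (i, j) = (1\<^sub>m N + \<beta> \<cdot>\<^sub>m H - dare_N G \<beta> H * feedback) $$ (i, j)"
      using eq by (rule arg_cong)
    also have "\<dots> = of_bool (j = i) + \<beta> * H $$ (i, j) - (dare_N G \<beta> H * feedback) $$ (i, j)"
      using i j NF carrier_matD[OF H_carrier] carrier_matD[OF NF] by (auto simp del: index_mult_mat)
    finally show ?thesis using index_mult_mat_sum[OF dare_N_carrier feedback_carrier i j] by simp
  qed
  have "(\<Sum>j<N. H $$ (i, j) * x j) = (\<Sum>j<N. of_bool (j = i) * x j + \<beta> * (H $$ (i, j) * x j)
      - (\<Sum>e<m. dare_N G \<beta> H $$ (i, e) * feedback $$ (e, j)) * x j)"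
  proof (rule sum.cong)
    fix j assume "j \<in> {..<N}"
    then have "j < N" by simp
    from arg_cong[OF entry[OF this], of "\<lambda>y. y * x j"]
    show "H $$ (i, j) * x j = of_bool (j = i) * x j + \<beta> * (H $$ (i, j) * x j)
      - (\<Sum>e<m. dare_N G \<beta> H $$ (i, e) * feedback $$ (e, j)) * x j"
      by (simp only: left_diff_distrib distrib_right mult.assoc)
  qed simp
  then show ?thesis
    unfolding sum_control sum_subtractf sum.distrib sum_distrib_left[symmetric] sum_of_bool_mult[OF i]
    by simp
qed

lemma outflow_eq: "outflow u i = (\<Sum>e<m. of_bool (i = tail G e) * u e)"
proof -
  have "(\<Sum>e<m. of_bool (i = tail G e) * u e) = (\<Sum>e\<in>out_arcs G i. u e)"
    by (rule sum.mono_neutral_cong_right) (auto simp: out_arcs_def arcs_eq)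
  then show ?thesis by (simp add: outflow_def)
qed

lemma inflow_eq: "inflow u i = (\<Sum>e<m. of_bool (i = head G e) * u e)"
proof -
  have "(\<Sum>e<m. of_bool (i = head G e) * u e) = (\<Sum>e\<in>in_arcs G i. u e)"
    by (rule sum.mono_neutral_cong_right) (auto simp: in_arcs_def arcs_eq)
  then show ?thesis by (simp add: inflow_def)
qed

lemma act_moved: "act P (moved u x) v = act P x v + (\<Sum>e<m. (P v (head G e) - P v (tail G e)) * u e)"
  using inner_moved[of u x "P v"] by (simp add: act_def inner_def arcs_eq mult.commute)

lemma riccati_pair_H: "riccati_pair (\<lambda>i j. H $$ (i, j)) control"
  unfolding riccati_pair_def
proof (intro conjI allI ballI)
  fix v w assume "v \<in> verts G" "w \<in> verts G"
  then show "H $$ (v, w) = H $$ (w, v)" using H_sym verts_eq by auto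
next
  fix x v assume "v \<in> verts G"
  then have v: "v < N" by (simp add: verts_eq)
  let ?P = "\<lambda>i j. H $$ (i, j)" let ?u = "control x"
  have "(\<Sum>e<m. dare_N G \<beta> H $$ (v, e) * ?u e)
      = (\<Sum>e<m. \<beta> * ((H $$ (v, head G e) - H $$ (v, tail G e)) * ?u e) - of_bool (v = tail G e) * ?u e)"
    by (intro sum.cong refl) (simp add: index_dare_N[OF v] algebra_simps)
  also have "\<dots> = \<beta> * (act ?P (moved ?u x) v - act ?P x v) - outflow ?u v"
    by (simp add: act_moved outflow_eq sum_subtractf flip: sum_distrib_left)
  finally show "act ?P x v = kept ?u x v + \<beta> * act ?P (moved ?u x) v"
    using dare_H_control[OF v, of x] unfolding right_diff_distrib
    by (simp add: act_def[of ?P x] kept_def verts_eq)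
next
  fix x e assume "e \<in> arcs G"
  then have e: "e < m" by (simp add: arcs_eq)
  let ?P = "\<lambda>i j. H $$ (i, j)" let ?u = "control x"
  let ?s = "tail G e" let ?t = "head G e"
  have "(\<Sum>q<m. dare_D G \<beta> H $$ (e, q) * ?u q) = (\<Sum>q<m. of_bool (?s = tail G q) * ?u q
      + \<beta> * ((H $$ (?t, head G q) - H $$ (?t, tail G q)) * ?u q)
      - \<beta> * ((H $$ (?s, head G q) - H $$ (?s, tail G q)) * ?u q))"
    by (intro sum.cong refl) (simp add: index_dare_D[OF e] arc_diff_def algebra_simps)
  also have "\<dots> = outflow ?u ?s + \<beta> * (act ?P (moved ?u x) ?t - act ?P x ?t)
      - \<beta> * (act ?P (moved ?u x) ?s - act ?P x ?s)"
    by (simp add: act_moved outflow_eq sum.distrib sum_subtractf flip: sum_distrib_left)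
  finally have lhs: "(\<Sum>q<m. dare_D G \<beta> H $$ (e, q) * ?u q) = \<dots>" .
  have "(\<Sum>j<N. dare_N G \<beta> H $$ (j, e) * x j)
      = (\<Sum>j<N. \<beta> * (H $$ (?t, j) * x j) - \<beta> * (H $$ (?s, j) * x j) - of_bool (j = ?s) * x j)"
  proof (rule sum.cong)
    fix j assume "j \<in> {..<N}"
    then have j: "j < N" by simp
    have entry: "dare_N G \<beta> H $$ (j, e) = - of_bool (j = ?s) + \<beta> * (H $$ (?t, j) - H $$ (?s, j))"
      unfolding index_dare_N[OF j e] H_sym[OF j ends_less(1)[OF e]] H_sym[OF j ends_less(2)[OF e]] ..
    show "dare_N G \<beta> H $$ (j, e) * x j
        = \<beta> * (H $$ (?t, j) * x j) - \<beta> * (H $$ (?s, j) * x j) - of_bool (j = ?s) * x j"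
      unfolding entry by (simp add: algebra_simps)
  qed simp
  also have "\<dots> = \<beta> * act ?P x ?t - \<beta> * act ?P x ?s - x ?s"
    using sum_of_bool_mult[OF ends_less(2)[OF e], of x]
    by (simp only: sum_subtractf sum_distrib_left[symmetric] act_def verts_eq)
  finally show "kept ?u x ?s = \<beta> * (act ?P (moved ?u x) ?t - act ?P (moved ?u x) ?s)"
    using dare_D_control[OF e, of x] lhs unfolding right_diff_distrib kept_def by linarith
qed

text \<open>
A nonzero \<open>w = \<beta> B\<^sup>T w\<close> is an eigenvector of \<open>(sqrt \<beta> B)\<^sup>T\<close> for the eigenvalue
\<open>1 / sqrt \<beta>\<close>, which lies outside the unit disk.
\<close>

lemma control_stable:
  assumes stab: "stabilizing G \<beta> H"
    and w: "\<And>x. inner x w = \<beta> * inner (moved (control x) x) w"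
  shows "\<forall>v\<in>verts G. w v = 0"
proof (rule ccontr)
  assume "\<not> ?thesis"
  then obtain v where v: "v < N" "w v \<noteq> 0" by (auto simp: verts_eq)
  define B where "B = 1\<^sub>m N - incidence_mat G * feedback"
  define A where "A = sqrt \<beta> \<cdot>\<^sub>m B"
  have CF: "incidence_mat G * feedback \<in> carrier_mat N N"
    by (rule mult_carrier_mat[OF incidence_mat_carrier feedback_carrier])
  then have B: "B \<in> carrier_mat N N" unfolding B_def by (rule minus_carrier_mat)
  then have A: "A \<in> carrier_mat N N" by (simp add: A_def)
  have Nt: "transpose_mat (dare_N G \<beta> H) \<in> carrier_mat m N" by simp
  have stab_A: "cmod z < 1" if "eigenvalue (map_mat complex_of_real A) z" for z
    using that stab unfolding stabilizing_def A_def B_def feedback_def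
      assoc_mult_mat[OF incidence_mat_carrier dare_Dinv_carrier Nt, symmetric] by (simp add: verts_eq)
  have B_entry: "moved (control (\<lambda>k. of_bool (k = j))) (\<lambda>k. of_bool (k = j)) i = B $$ (i, j)"
    if i: "i < N" and j: "j < N" for i j
  proof -
    have "control (\<lambda>k. of_bool (k = j)) e = - feedback $$ (e, j)" for e
      using sum_of_bool_mult[OF j, of "\<lambda>k. feedback $$ (e, k)"] by (simp add: control_def mult.commute)
    then have "moved (control (\<lambda>k. of_bool (k = j))) (\<lambda>k. of_bool (k = j)) i
        = of_bool (i = j) - (\<Sum>e<m. (of_bool (i = head G e) - of_bool (i = tail G e)) * feedback $$ (e, j))"
      by (simp only: moved_def outflow_eq inflow_eq left_diff_distrib sum_subtractf mult_minus_right sum_negf)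
    also have "\<dots> = of_bool (i = j) - (incidence_mat G * feedback) $$ (i, j)"
      unfolding index_mult_mat_sum[OF incidence_mat_carrier feedback_carrier i j]
      using i by (simp add: index_incidence_mat del: of_bool_eq_iff)
    also have "\<dots> = B $$ (i, j)"
      unfolding B_def using i j carrier_matD[OF CF] by (auto simp del: index_mult_mat)
    finally show ?thesis .
  qed
  have w_eq: "w j = \<beta> * (\<Sum>i<N. B $$ (i, j) * w i)" if j: "j < N" for j
  proof -
    have "w j = \<beta> * inner (moved (control (\<lambda>k. of_bool (k = j))) (\<lambda>k. of_bool (k = j))) w"
      using w[of "\<lambda>k. of_bool (k = j)"] inner_indicator[of j w] j by (simp add: verts_eq)
    also have "inner (moved (control (\<lambda>k. of_bool (k = j))) (\<lambda>k. of_bool (k = j))) w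
        = (\<Sum>i<N. B $$ (i, j) * w i)"
      unfolding inner_def verts_eq by (rule sum.cong) (simp_all add: B_entry j)
    finally show ?thesis .
  qed
  have "transpose_mat A *\<^sub>v vec N w = (1 / sqrt \<beta>) \<cdot>\<^sub>v vec N w"
  proof (rule eq_vecI)
    fix j assume "j < dim_vec ((1 / sqrt \<beta>) \<cdot>\<^sub>v vec N w)"
    then have j: "j < N" by simp
    have "(transpose_mat A *\<^sub>v vec N w) $ j = (\<Sum>i<N. A $$ (i, j) * w i)"
      using A j by (simp add: scalar_prod_def atLeast0LessThan)
    also have "\<dots> = sqrt \<beta> * (\<Sum>i<N. B $$ (i, j) * w i)"
      using B j by (simp add: A_def sum_distrib_left mult.assoc)
    also have "\<dots> = sqrt \<beta> / \<beta> * w j"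
      using w_eq[OF j] beta_pos by simp
    also have "sqrt \<beta> / \<beta> = 1 / sqrt \<beta>"
      using beta_pos by (simp add: real_div_sqrt field_simps)
    finally show "(transpose_mat A *\<^sub>v vec N w) $ j = ((1 / sqrt \<beta>) \<cdot>\<^sub>v vec N w) $ j"
      using j by simp
  qed (use A in simp)
  moreover have "vec N w \<noteq> 0\<^sub>v N" using v by (metis index_vec index_zero_vec(1))
  ultimately have "eigenvalue (transpose_mat A) (1 / sqrt \<beta>)"
    using A unfolding eigenvalue_def eigenvector_def by (intro exI[of _ "vec N w"]) simp
  then have "eigenvalue A (1 / sqrt \<beta>)"
    using A eigenvalue_root_char_poly[OF A] eigenvalue_root_char_poly[of "transpose_mat A" N] by simp
  then have "eigenvalue (map_mat complex_of_real A) (complex_of_real (1 / sqrt \<beta>))"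
    by (rule of_real_hom.eigenvalue_hom[OF A])
  then have "cmod (complex_of_real (1 / sqrt \<beta>)) < 1" by (rule stab_A)
  then have "1 / sqrt \<beta> < 1" using beta_pos by (simp only: norm_of_real)
  then show False using beta_pos beta_less_1 by (simp add: field_simps)
qed


section \<open>Support of the gain\<close>

lemma H_eq_optimal_value:
  assumes "stabilizing G \<beta> H" "i < N" "j < N"
  shows "H $$ (i, j) = optimal_value i j"
proof (rule riccati_pair_unique[OF riccati_pair_H])
  show "\<forall>v\<in>verts G. w v = 0" if "\<And>x. inner x w = \<beta> * inner (moved (control x) x) w" for w
    using assms(1) that by (rule control_stable)
qed (use assms(2,3) in \<open>simp_all add: verts_eq\<close>)

lemma height_component_eq: "height_component G h e = component (h (head G e)) (head G e)"
  by (simp add: height_component_def component_def arc_level_def)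

lemma arc_diff_support:
  assumes "stabilizing G \<beta> H" "p < m" "q < m" "arc_diff p q \<noteq> 0"
  shows "(arc_level G h p, height_component G h p) = (arc_level G h q, height_component G h q)"
proof -
  have "p \<in> arcs G" "q \<in> arcs G" using assms(2,3) by (simp_all add: arcs_eq)
  moreover have "optimal_value (head G p) (head G q) - optimal_value (tail G p) (head G q)
      - (optimal_value (head G p) (tail G q) - optimal_value (tail G p) (tail G q)) \<noteq> 0"
    using assms(4) by (simp only: arc_diff_def H_eq_optimal_value[OF assms(1)] ends_less assms(2,3) simp_thms)
  ultimately show ?thesis
    unfolding arc_level_def height_component_eq prod.inject by (rule optimal_value_arcs_support)
qed

lemma dare_D_support:
  assumes "stabilizing G \<beta> H" "p < m" "q < m" "dare_D G \<beta> H $$ (p, q) \<noteq> 0"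
  shows "(p, q) \<in> P_D G h"
proof -
  have "tail G p = tail G q \<or> arc_diff p q \<noteq> 0"
    using assms(4) index_dare_D[OF assms(2,3)] by auto
  then show ?thesis
    using arc_diff_support[OF assms(1-3)] assms(2,3) by (auto simp: P_D_def arcs_eq)
qed

lemma P_D_trancl_sym: "(p, q) \<in> (P_D G h)\<^sup>+ \<Longrightarrow> (q, p) \<in> (P_D G h)\<^sup>+"
proof -
  have "sym (P_D G h)" by (rule symI) (auto simp: P_D_def)
  then show "(p, q) \<in> (P_D G h)\<^sup>+ \<Longrightarrow> (q, p) \<in> (P_D G h)\<^sup>+"
    by (rule symD[OF sym_trancl])
qed

text \<open>
Setting the entries of the inverse outside the equivalence relation generated by \<open>P_D\<close> to zero
gives again a left inverse, since \<open>D\<close> only connects equivalent indices. Inverses are unique.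
\<close>

lemma dare_Dinv_support:
  assumes stab: "stabilizing G \<beta> H" and p: "p < m" and k: "k < m"
    and nz: "dare_Dinv G \<beta> H $$ (p, k) \<noteq> 0"
  shows "(p, k) \<in> (P_D G h)\<^sup>+"
proof -
  let ?D = "dare_D G \<beta> H" let ?I = "dare_Dinv G \<beta> H" let ?E = "(P_D G h)\<^sup>+"
  define M where "M = mat m m (\<lambda>(i, j). if (i, j) \<in> ?E then ?I $$ (i, j) else 0)"
  have M: "M \<in> carrier_mat m m" by (simp add: M_def)
  have "M * ?D = 1\<^sub>m m"
  proof (rule eq_matI)
    fix i j assume "i < dim_row (1\<^sub>m m :: real mat)" "j < dim_col (1\<^sub>m m :: real mat)"
    then have i: "i < m" and j: "j < m" by simp_all
    have "(M * ?D) $$ (i, j) = (\<Sum>q<m. of_bool ((i, j) \<in> ?E) * (?I $$ (i, q) * ?D $$ (q, j)))"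
      unfolding index_mult_mat_sum[OF M dare_D_carrier i j]
    proof (rule sum.cong)
      fix q assume "q \<in> {..<m}"
      then have q: "q < m" by simp
      have "(i, q) \<in> ?E \<longleftrightarrow> (i, j) \<in> ?E" if "?D $$ (q, j) \<noteq> 0"
      proof -
        have qj: "(q, j) \<in> ?E" using dare_D_support[OF stab q j that] by (rule r_into_trancl)
        show ?thesis
        proof
          show "(i, j) \<in> ?E" if "(i, q) \<in> ?E" using that qj by (rule trancl_trans)
          show "(i, q) \<in> ?E" if "(i, j) \<in> ?E" using that P_D_trancl_sym[OF qj] by (rule trancl_trans)
        qed
      qed
      then show "M $$ (i, q) * ?D $$ (q, j) = of_bool ((i, j) \<in> ?E) * (?I $$ (i, q) * ?D $$ (q, j))"
        using i q by (auto simp: M_def)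
    qed simp
    also have "\<dots> = of_bool ((i, j) \<in> ?E) * (?I * ?D) $$ (i, j)"
      unfolding sum_distrib_left[symmetric] index_mult_mat_sum[OF dare_Dinv_carrier dare_D_carrier i j] ..
    also have "\<dots> = (1\<^sub>m m :: real mat) $$ (i, j)"
    proof (cases "i = j")
      case True
      have "(i, i) \<in> ?E" using i by (intro r_into_trancl) (simp add: P_D_def arcs_eq)
      then show ?thesis unfolding dare_Dinv_D using i True by simp
    next
      case False
      then show ?thesis unfolding dare_Dinv_D using i j by simp
    qed
    finally show "(M * ?D) $$ (i, j) = (1\<^sub>m m :: real mat) $$ (i, j)" .
  qed (use M in simp_all)
  have "M = M * (?D * ?I)" unfolding dare_D_Dinv using M by simp
  also have "\<dots> = (M * ?D) * ?I" using assoc_mult_mat[OF M dare_D_carrier dare_Dinv_carrier] by simp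
  also have "\<dots> = ?I" unfolding \<open>M * ?D = 1\<^sub>m m\<close> by (rule left_mult_one_mat[OF dare_Dinv_carrier])
  finally have "M $$ (p, k) \<noteq> 0" using nz by simp
  then show ?thesis using p k by (simp add: M_def split: if_splits)
qed

text \<open>
The entries of \<open>F C = - sqrt \<beta> D\<^sup>-\<^sup>1 (\<beta> C\<^sup>T H C - S\<^sup>T C)\<close>, where the rows of
\<open>S\<^sup>T C\<close> are the rows of \<open>C\<close> at the tails.
\<close>

lemma index_gain_basis:
  assumes p: "p < m" and q: "q < m"
  shows "(gain_mat G \<beta> H * basis_mat G) $$ (p, q)
    = - sqrt \<beta> * (\<Sum>k<m. dare_Dinv G \<beta> H $$ (p, k) * (\<beta> * arc_diff k q - incidence_mat G $$ (tail G k, q)))"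
proof -
  let ?I = "dare_Dinv G \<beta> H"
  define L where "L = - transpose_mat (sender_mat G) + \<beta> \<cdot>\<^sub>m (transpose_mat (incidence_mat G) * H)"
  have L: "L \<in> carrier_mat m N" by (rule carrier_matI) (simp_all add: L_def)
  have IL: "?I * L \<in> carrier_mat m N" by (rule mult_carrier_mat[OF dare_Dinv_carrier L])
  have gain: "gain_mat G \<beta> H = (- sqrt \<beta>) \<cdot>\<^sub>m (?I * L)" by (simp add: gain_mat_def L_def)
  then have F: "gain_mat G \<beta> H \<in> carrier_mat m N" using IL by simp
  have L_entry: "L $$ (k, i) = \<beta> * (H $$ (head G k, i) - H $$ (tail G k, i)) - of_bool (i = tail G k)"
    if "k < m" "i < N" for k i
    using that index_incidence_transpose_mult[OF H_carrier that]
    by (simp add: L_def index_sender_mat del: index_mult_mat(1))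
  have F_entry: "gain_mat G \<beta> H $$ (p, i) = - sqrt \<beta> * (\<Sum>k<m. ?I $$ (p, k) * L $$ (k, i))" if "i < N" for i
    using index_mult_mat_sum[OF dare_Dinv_carrier L p that] p that carrier_matD[OF IL]
    by (simp add: gain del: index_mult_mat)
  have basis: "basis_mat G \<in> carrier_mat N (Suc m)"
    by (rule carrier_matI) (simp_all add: basis_mat_def verts_eq)
  have basis_entry: "basis_mat G $$ (i, q) = incidence_mat G $$ (i, q)" if "i < N" for i
    using that q by (simp add: basis_mat_def verts_eq mat_of_cols_index nth_append)
  have "(gain_mat G \<beta> H * basis_mat G) $$ (p, q) = (gain_mat G \<beta> H * incidence_mat G) $$ (p, q)"
    using q unfolding index_mult_mat_sum[OF F incidence_mat_carrier p q]
    by (subst index_mult_mat_sum[OF F basis p]) (simp_all add: basis_entry)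
  also have "\<dots> = gain_mat G \<beta> H $$ (p, head G q) - gain_mat G \<beta> H $$ (p, tail G q)"
    by (rule index_mult_incidence[OF F p q])
  also have "\<dots> = - sqrt \<beta> * (\<Sum>k<m. ?I $$ (p, k) * (L $$ (k, head G q) - L $$ (k, tail G q)))"
    by (simp only: F_entry ends_less[OF q] right_diff_distrib sum_subtractf)
  also have "(\<Sum>k<m. ?I $$ (p, k) * (L $$ (k, head G q) - L $$ (k, tail G q)))
      = (\<Sum>k<m. ?I $$ (p, k) * (\<beta> * arc_diff k q - incidence_mat G $$ (tail G k, q)))"
  proof (rule sum.cong)
    fix k assume "k \<in> {..<m}"
    then have k: "k < m" by simp
    have "L $$ (k, head G q) - L $$ (k, tail G q)
        = \<beta> * arc_diff k q - incidence_mat G $$ (tail G k, q)"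
      by (simp add: L_entry k ends_less q index_incidence_mat arc_diff_def algebra_simps)
    then show "?I $$ (p, k) * (L $$ (k, head G q) - L $$ (k, tail G q))
        = ?I $$ (p, k) * (\<beta> * arc_diff k q - incidence_mat G $$ (tail G k, q))" by simp
  qed simp
  finally show ?thesis .
qed

lemma gain_support:
  assumes stab: "stabilizing G \<beta> H"
  shows "P_F G \<beta> H \<subseteq> (P_D G h)\<^sup>+ O P_G G h"
proof (rule subrelI)
  fix p q assume "(p, q) \<in> P_F G \<beta> H"
  then have p: "p < m" and q: "q < m" and F: "(gain_mat G \<beta> H * basis_mat G) $$ (p, q) \<noteq> 0"
    by (simp_all add: P_F_def arcs_eq)
  have "(\<Sum>k<m. dare_Dinv G \<beta> H $$ (p, k)
      * (\<beta> * arc_diff k q - incidence_mat G $$ (tail G k, q))) \<noteq> 0"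
    using F unfolding index_gain_basis[OF p q] by (metis mult_zero_right)
  then obtain k where "k \<in> {..<m}"
    and nz: "dare_Dinv G \<beta> H $$ (p, k) * (\<beta> * arc_diff k q - incidence_mat G $$ (tail G k, q)) \<noteq> 0"
    by (rule sum.not_neutral_contains_not_neutral)
  then have k: "k < m" by simp
  have "(p, k) \<in> (P_D G h)\<^sup>+" using dare_Dinv_support[OF stab p k] nz by simp
  moreover have "incidence_mat G $$ (tail G k, q) \<noteq> 0 \<or> arc_diff k q \<noteq> 0" using nz by auto
  then have "(k, q) \<in> P_G G h"
    using arc_diff_support[OF stab k q] k q by (auto simp: P_G_def arcs_eq)
  ultimately show "(p, q) \<in> (P_D G h)\<^sup>+ O P_G G h" by (rule relcompI)
qed

end

theorem proposition2:
  fixes G :: "(nat, nat) pre_digraph" and N m :: nat and \<beta> :: real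
    and H :: "real mat" and h :: "nat \<Rightarrow> nat"
  assumes "directed_tree G" and "verts G = {..<N}" and "arcs G = {..<m}"
    and "0 < \<beta>" and "\<beta> < 1"
    and "reduced_dare_solution G \<beta> H" and "stabilizing G \<beta> H" and "pos_semidef H"
    and "height_function G h"
  shows "P_F G \<beta> H \<subseteq> (P_D G h)\<^sup>+ O P_G G h"
proof -
  interpret fin_digraph G using assms(1) by (simp add: directed_tree_def)
  interpret dare_solution G h \<beta> N m H
  proof unfold_locales
    show "Digraph_Component.connected G" using assms(1) by (simp add: directed_tree_def)
    show "h (head G e) = Suc (h (tail G e))" if "e \<in> arcs G" for e
      using assms(9) that by (simp add: height_function_def)
  qed (rule assms)+
  show ?thesis by (rule gain_support[OF assms(7)])
qed

end
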